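(* Let $h_2(z)=\eta^2(z)\eta^2(2z)$, and let $\nu_\pm$ be the multiplier systems on $\Gamma^*(2)$ defined below. (a) For every integer $d>0$ with $d\equiv1\pmod4$ and each choice of sign there is a unique form $f_d^{\pm}=q^{-d/4}+\sum_{n>0,\ n\equiv3\bmod4}a_d^\pm(n)q^{n/4}\in M_2^!(\Gamma^*(2),\bar\nu_\pm)$. (b) For every integer $d>0$ with $d\equiv3\pmod4$ there are unique forms $f_d^{+}=q^{-d/4}+\sum_{n>0,\ n\equiv1\bmod4}a_d^+(n)q^{n/4}\in M_2^!(\Gamma^*(2),\nu_+)$ and $f_d^{-}=q^{-d/4}+\sum_{n\ge5,\ n\equiv1\bmod4}a_d^-(n)q^{n/4}\in M_2^!(\Gamma^*(2),\nu_-)$. (c) For every odd prime $p$ and every $n\ge1$ we have $f_1^+|T_2^{(4)}(p^n)=p^nf^+_{p^n}$. If $p^n\equiv1\pmod4$ then $f_1^-|T_2^{(4)}(p^n)=p^nf^-_{p^n}$. If $p^n\equiv3\pmod4$ then $f_1^-|T_2^{(4)}(p^n)=p^nf^-_{p^n}+a_1^-(p^n)\,h_2$.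
   Context: $q=e^{2\pi iz}$, $\eta(z)=q^{1/24}\prod_{n\ge1}(1-q^n)$. $\Gamma^*(2)$ is the Fricke group generated by $\Gamma_0(2)$ and $W_2=\begin{pmatrix}0&-1\\2&0\end{pmatrix}$ (equivalently by $\begin{pmatrix}1&1\\0&1\end{pmatrix}$ and $W_2$). $\nu_\pm$ is the character of $\Gamma^*(2)$ given by $\nu_\pm(\gamma)=i^{d(b-c/2)}$ for $\gamma=\begin{pmatrix}a&b\\c&d\end{pmatrix}\in\Gamma_0(2)$ (the multiplier system of $h_2$ on $\Gamma_0(2)$) and $\nu_\pm(W_2)=\pm1$; $\bar\nu_\pm$ is its complex conjugate. For $\gamma\in GL_2^+(\mathbb{Q})$, $f|_k\gamma(z)=(\det\gamma)^{k/2}(cz+d)^{-k}f(\gamma z)$. $M_k^!(\Gamma,\chi)$ is the space of holomorphic functions on the upper half-plane, meromorphic at the cusps, with $f|_k\gamma=\chi(\gamma)f$ for all $\gamma\in\Gamma$. For a prime $p$, $f|T_k^{(t)}(p)=p^{k/2-1}\left(\sum_{\lambda=0}^{p-1}f|_k\begin{pmatrix}1&t\lambda\\0&p\end{pmatrix}+f|_k\begin{pmatrix}p&0\\0&1\end{pmatrix}\right)$, acting on $f=\sum a(n)q^{n/t}$ by $\sum(a(pn)+p^{k-1}a(n/p))q^{n/t}$; $T_k^{(t)}(1)=\mathrm{id}$, $T_k^{(t)}(p^{n+1})=T_k^{(t)}(p^n)T_k^{(t)}(p)-p^{k-1}T_k^{(t)}(p^{n-1})$. In (c), $f^\pm_{p^n}$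 are the forms from (a) or (b) according to $p^n\bmod4$, and $a_1^-(m)$ is the coefficient of $q^{m/4}$ in $f_1^-$. *)

theory Defs
  imports "HOL-Analysis.Analysis" "HOL-Computational_Algebra.Primes"
begin

definition Hplane :: "complex set" where
  "Hplane = {z. Im z > 0}"

definition slash :: "int \<Rightarrow> real \<times> real \<times> real \<times> real \<Rightarrow> (complex \<Rightarrow> complex) \<Rightarrow> complex \<Rightarrow> complex" where
  "slash k M f z = (case M of (a, b, c, d) \<Rightarrow>
      complex_of_real ((a * d - b * c) powr (of_int k / 2))
      * (of_real c * z + of_real d) powi (- k)
      * f ((of_real a * z + of_real b) / (of_real c * z + of_real d)))"

abbreviation imat :: "int \<Rightarrow> int \<Rightarrow> int \<Rightarrow> int \<Rightarrow> real \<times> real \<times> real \<times> real" where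
  "imat a b c d \<equiv> (of_int a, of_int b, of_int c, of_int d)"

definition qpow :: "nat \<Rightarrow> int \<Rightarrow> complex \<Rightarrow> complex" where
  "qpow t n z = exp (2 * of_real pi * \<i> * of_int n * z / of_nat t)"

definition mero_at_infty :: "(complex \<Rightarrow> complex) \<Rightarrow> bool" where
  "mero_at_infty f \<longleftrightarrow> (\<exists>h::nat. h > 0 \<and> (\<exists>(a::int \<Rightarrow> complex) N.
      (\<forall>n. n < N \<longrightarrow> a n = 0) \<and>
      (\<forall>z\<in>Hplane. ((\<lambda>n. a n * qpow h n z) has_sum f z) UNIV)))"

definition mero_at_cusps :: "int \<Rightarrow> (complex \<Rightarrow> complex) \<Rightarrow> bool" where
  "mero_at_cusps k f \<longleftrightarrow> (\<forall>a b c d. a * d - b * c = 1 \<longrightarrow> mero_at_infty (slash k (imat a b c d) f))"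

definition nu0 :: "int \<Rightarrow> int \<Rightarrow> int \<Rightarrow> int \<Rightarrow> complex" where
  "nu0 a b c d = \<i> powi (d * (b - c div 2))"

definition nu0_conj :: "int \<Rightarrow> int \<Rightarrow> int \<Rightarrow> int \<Rightarrow> complex" where
  "nu0_conj a b c d = cnj (nu0 a b c d)"

text \<open>M_k^!(Gamma*(2), chi), where chi is given by its values chi0 on Gamma_0(2)
  and its value w on the Fricke involution W_2 = (0,-1;2,0); since Gamma*(2) is generated
  by Gamma_0(2) and W_2, the transformation law is required on these generators.\<close>
definition wh_form :: "int \<Rightarrow> (int \<Rightarrow> int \<Rightarrow> int \<Rightarrow> int \<Rightarrow> complex) \<Rightarrow> complex \<Rightarrow> (complex \<Rightarrow> complex) \<Rightarrow> bool" where
  "wh_form k chi0 w f \<longleftrightarrow>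
     f holomorphic_on Hplane \<and>
     (\<forall>a b c d. a * d - b * c = 1 \<and> even c \<longrightarrow>
        (\<forall>z\<in>Hplane. slash k (imat a b c d) f z = chi0 a b c d * f z)) \<and>
     (\<forall>z\<in>Hplane. slash k (imat 0 (-1) 2 0) f z = w * f z) \<and>
     mero_at_cusps k f"

definition qexp_coeffs :: "nat \<Rightarrow> nat set \<Rightarrow> (nat \<Rightarrow> complex) \<Rightarrow> (complex \<Rightarrow> complex) \<Rightarrow> bool" where
  "qexp_coeffs d S a f \<longleftrightarrow>
     (\<forall>z\<in>Hplane. ((\<lambda>n. a n * qpow 4 (int n) z) has_sum (f z - qpow 4 (- int d) z)) S)"

definition qexp_shape :: "nat \<Rightarrow> nat set \<Rightarrow> (complex \<Rightarrow> complex) \<Rightarrow> bool" where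
  "qexp_shape d S f \<longleftrightarrow> (\<exists>a. qexp_coeffs d S a f)"

definition S1 :: "nat set" where "S1 = {n. n > 0 \<and> n mod 4 = 1}"
definition S3 :: "nat set" where "S3 = {n. n > 0 \<and> n mod 4 = 3}"
definition S5 :: "nat set" where "S5 = {n. n \<ge> 5 \<and> n mod 4 = 1}"

text \<open>The defining property of f_d^s (s = 1 for +, s = -1 for -), according to d mod 4:
  part (a) if d = 1 mod 4, part (b) if d = 3 mod 4.\<close>
definition fd_prop :: "complex \<Rightarrow> nat \<Rightarrow> (complex \<Rightarrow> complex) \<Rightarrow> bool" where
  "fd_prop s d f \<longleftrightarrow>
     (if d mod 4 = 1 then wh_form 2 nu0_conj s f \<and> qexp_shape d S3 f
      else wh_form 2 nu0 s f \<and> qexp_shape d (if s = 1 then S1 else S5) f)"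

definition eta :: "complex \<Rightarrow> complex" where
  "eta z = exp (2 * of_real pi * \<i> * z / 24) * prodinf (\<lambda>n. 1 - exp (2 * of_real pi * \<i> * z) ^ Suc n)"

definition h2 :: "complex \<Rightarrow> complex" where
  "h2 z = eta z ^ 2 * eta (2 * z) ^ 2"

definition heckeP :: "int \<Rightarrow> nat \<Rightarrow> nat \<Rightarrow> (complex \<Rightarrow> complex) \<Rightarrow> complex \<Rightarrow> complex" where
  "heckeP k t p f z = complex_of_real (real p powr (of_int k / 2 - 1)) *
     ((\<Sum>j<p. slash k (1, real (t * j), 0, real p) f z) + slash k (real p, 0, 0, 1) f z)"

fun hecke :: "int \<Rightarrow> nat \<Rightarrow> nat \<Rightarrow> nat \<Rightarrow> (complex \<Rightarrow> complex) \<Rightarrow> complex \<Rightarrow> complex" where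
  "hecke k t p 0 f = f"
| "hecke k t p (Suc 0) f = heckeP k t p f"
| "hecke k t p (Suc (Suc n)) f =
     (\<lambda>z. heckeP k t p (hecke k t p (Suc n) f) z
          - complex_of_real (real p powr (of_int k - 1)) * hecke k t p n f z)"

end

theory Submission
  imports Defs "HOL-Complex_Analysis.Complex_Analysis" "HOL-Real_Asymp.Real_Asymp" "HOL-Number_Theory.Cong"
begin

text \<open>
  With \<open>\<psi>(z) = (\<eta>(z) / \<eta>(2z))\<^sup>1\<^sup>2\<close> one has \<open>h\<^sub>2(-1/2z) = -2z\<^sup>2 h\<^sub>2(z)\<close> and
  \<open>\<psi>(-1/2z) = 64 / \<psi>(z)\<close>, so \<open>h\<^sub>2 (\<psi>\<^sup>k - s 64\<^sup>k \<psi>\<^sup>-\<^sup>k)\<close> transforms correctly for the sign \<open>s\<close>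
  and begins with \<open>q\<^sup>-\<^sup>d\<^sup>/\<^sup>4\<close> for \<open>d = 2k - 1\<close>; eliminating with these functions and \<open>h\<^sub>2\<close> one can
  prescribe the coefficients of nonpositive index and, if \<open>s = -1\<close>, that of \<open>q\<^sup>1\<^sup>/\<^sup>4\<close>.  These
  coefficients determine the form: if they vanish, the quotient \<open>G\<close> by the zero-free \<open>h\<^sub>2\<close> has a
  limit at infinity and \<open>G\<^sup>4\<close> is invariant, so by the maximum principle \<open>G\<^sup>4\<close> is constant, and it
  vanishes at infinity or, if \<open>s = 1\<close>, at the fixed point of \<open>W\<^sub>2\<close>.  The Hecke operators preserve
  the transformation laws, so the Hecke relations only require comparing these coefficients.
  The law of \<open>\<eta>\<^sup>2\<close> under \<open>z \<mapsto> -1/z\<close> comes from its logarithmic derivative, i.e. from Eisenstein's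
  conditionally convergent double series.
\<close>

section \<open>The slash operator\<close>

lemma in_Hplane_iff: "z \<in> Hplane \<longleftrightarrow> Im z > 0"
  by (simp add: Hplane_def)

lemma open_Hplane: "open Hplane"
  unfolding Hplane_def by (rule open_halfspace_Im_gt)

lemma convex_Hplane: "convex Hplane"
  unfolding Hplane_def by (rule convex_halfspace_Im_gt)

lemma Hplane_nonzero: "z \<in> Hplane \<Longrightarrow> z \<noteq> 0"
  by (auto simp: in_Hplane_iff)

type_synonym mat2 = "real \<times> real \<times> real \<times> real"

definition det2 :: "mat2 \<Rightarrow> real" where
  "det2 M = (case M of (a, b, c, d) \<Rightarrow> a * d - b * c)"

definition mat2_mult :: "mat2 \<Rightarrow> mat2 \<Rightarrow> mat2" (infixl "\<odot>" 70) where
  "M \<odot> N = (case M of (a, b, c, d) \<Rightarrow> case N of (a', b', c', d') \<Rightarrow>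
     (a * a' + b * c', a * b' + b * d', c * a' + d * c', c * b' + d * d'))"

definition mat2_act :: "mat2 \<Rightarrow> complex \<Rightarrow> complex" where
  "mat2_act M z = (case M of (a, b, c, d) \<Rightarrow> moebius (of_real a) (of_real b) (of_real c) (of_real d) z)"

definition automorphy :: "mat2 \<Rightarrow> complex \<Rightarrow> complex" where
  "automorphy M z = (case M of (a, b, c, d) \<Rightarrow> of_real c * z + of_real d)"

lemma det2_tuple: "det2 (a, b, c, d) = a * d - b * c"
  by (simp add: det2_def)

lemma det2_mult: "det2 (M \<odot> N) = det2 M * det2 N"
  by (cases M; cases N) (simp add: det2_tuple mat2_mult_def algebra_simps)

lemma imat_mult:
  "imat a b c d \<odot> imat a' b' c' d' = imat (a * a' + b * c') (a * b' + b * d') (c * a' + d * c') (c * b' + d * d')"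
  by (simp add: mat2_mult_def)

lemma det2_imat: "det2 (imat a b c d) = of_int (a * d - b * c)"
  by (simp add: det2_def)

lemma automorphy_nonzero:
  assumes "det2 M \<noteq> 0" "z \<in> Hplane"
  shows "automorphy M z \<noteq> 0"
proof
  obtain a b c d where M: "M = (a, b, c, d)"
    by (cases M)
  assume "automorphy M z = 0"
  hence "c * Im z = 0" "c * Re z + d = 0"
    by (simp_all add: automorphy_def M complex_eq_iff)
  hence "c = 0" "d = 0"
    using assms(2) by (auto simp: in_Hplane_iff)
  with assms(1) show False
    by (simp add: det2_def M)
qed

lemma Im_mat2_act: "Im (mat2_act M z) = det2 M * Im z / (norm (automorphy M z))\<^sup>2"
  unfolding Im_divide cmod_power2 mat2_act_def moebius_def automorphy_def det2_def
  by (simp add: algebra_simps Im_divide split: prod.splits)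

lemma mat2_act_in_Hplane: "det2 M > 0 \<Longrightarrow> z \<in> Hplane \<Longrightarrow> mat2_act M z \<in> Hplane"
  using automorphy_nonzero[of M z] by (simp add: in_Hplane_iff Im_mat2_act)

lemma mat2_act_mult:
  assumes "det2 N \<noteq> 0" "z \<in> Hplane"
  shows "mat2_act (M \<odot> N) z = mat2_act M (mat2_act N z)"
proof -
  obtain a b c d a' b' c' d' where MN: "M = (a, b, c, d)" "N = (a', b', c', d')"
    by (cases M, cases N)
  have "of_real c' * z + of_real d' \<noteq> 0"
    using automorphy_nonzero[OF assms] by (simp add: automorphy_def MN)
  thus ?thesis
    by (simp add: mat2_act_def moebius_def mat2_mult_def MN divide_simps) (simp add: algebra_simps)
qed

lemma automorphy_mult:
  assumes "det2 N \<noteq> 0" "z \<in> Hplane"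
  shows "automorphy (M \<odot> N) z = automorphy M (mat2_act N z) * automorphy N z"
  using automorphy_nonzero[OF assms]
  by (simp add: automorphy_def mat2_act_def moebius_def mat2_mult_def field_simps split: prod.splits)

lemma slash_conv_mat2_act:
  "slash k M f z = of_real (det2 M powr (of_int k / 2)) * automorphy M z powi (- k) * f (mat2_act M z)"
  by (simp add: slash_def det2_def automorphy_def mat2_act_def moebius_def split: prod.splits)

lemma slash_slash:
  assumes "det2 M > 0" "det2 N > 0" "z \<in> Hplane"
  shows "slash k N (slash k M f) z = slash k (M \<odot> N) f z"
  using assms by (simp add: slash_conv_mat2_act mat2_act_mult automorphy_mult det2_mult powr_mult
      power_int_mult_distrib mult_ac)

lemma slash_cong:
  assumes "\<And>z. z \<in> Hplane \<Longrightarrow> f z = g z" "det2 M > 0" "z \<in> Hplane"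
  shows "slash k M f z = slash k M g z"
  using assms mat2_act_in_Hplane by (simp add: slash_conv_mat2_act)

lemma slash_cmult: "slash k M (\<lambda>z. c * f z) z = c * slash k M f z"
  by (simp add: slash_conv_mat2_act)

lemma slash_add: "slash k M (\<lambda>z. f z + g z) z = slash k M f z + slash k M g z"
  by (simp add: slash_conv_mat2_act distrib_left)

lemma slash_sum: "slash k M (\<lambda>z. \<Sum>j\<in>J. f j z) z = (\<Sum>j\<in>J. slash k M (f j) z)"
  by (simp add: slash_conv_mat2_act sum_distrib_left)

lemma slash_scale:
  assumes "even k" "r \<noteq> 0" "det2 (a, b, c, d) > 0"
  shows "slash k (r * a, r * b, r * c, r * d) f z = slash k (a, b, c, d) f z"
proof -
  have act: "mat2_act (r * a, r * b, r * c, r * d) z = mat2_act (a, b, c, d) z"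
    using assms(2) mult_divide_mult_cancel_left[of "of_real r" "of_real a * z + of_real b" "of_real c * z + of_real d"]
    by (simp add: mat2_act_def moebius_def algebra_simps)
  have automorphy: "automorphy (r * a, r * b, r * c, r * d) z = of_real r * automorphy (a, b, c, d) z"
    by (simp add: automorphy_def algebra_simps)
  obtain m where m: "k = 2 * m"
    using assms(1) by blast
  have "(r\<^sup>2) powr (of_int k / 2) = r powi k"
    using assms(2) by (simp add: m powr_real_of_int' power_int_mult)
  moreover have "det2 (r * a, r * b, r * c, r * d) = r\<^sup>2 * det2 (a, b, c, d)"
    by (simp add: det2_def power2_eq_square algebra_simps)
  ultimately have "det2 (r * a, r * b, r * c, r * d) powr (of_int k / 2) =
      r powi k * det2 (a, b, c, d) powr (of_int k / 2)"
    using assms(3) by (simp add: powr_mult)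
  moreover have "(of_real (r powi k) :: complex) * of_real r powi (- k) = 1"
    using assms(2) by (simp add: power_int_minus)
  ultimately show ?thesis
    unfolding slash_conv_mat2_act act automorphy power_int_mult_distrib by simp
qed

lemma slash_translation: "slash k (1, x, 0, 1) f z = f (z + of_real x)"
  by (simp add: slash_def)

lemma slash_holomorphic:
  assumes "f holomorphic_on Hplane" "det2 M > 0"
  shows "slash k M f holomorphic_on Hplane"
proof -
  have nonzero: "automorphy M z \<noteq> 0" if "z \<in> Hplane" for z
    using automorphy_nonzero[of M z] assms(2) that by simp
  have "automorphy M holomorphic_on Hplane"
    unfolding automorphy_def[abs_def] by (cases M) (auto intro!: holomorphic_intros)
  moreover have "mat2_act M holomorphic_on Hplane"
    using nonzero unfolding automorphy_def mat2_act_def[abs_def] moebius_def by (cases M) (auto intro!: holomorphic_intros)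
  hence "(\<lambda>z. f (mat2_act M z)) holomorphic_on Hplane"
    by (rule holomorphic_on_compose_gen[OF _ assms(1), unfolded o_def]) (auto intro: mat2_act_in_Hplane assms(2))
  ultimately have "(\<lambda>z. of_real (det2 M powr (of_int k / 2)) * automorphy M z powi (- k) * f (mat2_act M z))
      holomorphic_on Hplane"
    using nonzero by (intro holomorphic_intros holomorphic_on_power_int) auto
  thus ?thesis
    by (simp add: slash_conv_mat2_act[abs_def])
qed

lemma shift_int_multiplier:
  fixes f :: "complex \<Rightarrow> complex"
  assumes step: "\<And>z. z \<in> Hplane \<Longrightarrow> f (z + 1) = c * f z" and c: "c \<noteq> 0" and z: "z \<in> Hplane"
  shows "f (z + of_int n) = c powi n * f z"
proof (induction n rule: int_induct[where k = 0])
  case (step1 i)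
  thus ?case
    using step[of "z + of_int i"] z c by (simp add: in_Hplane_iff power_int_add add.assoc)
next
  case (step2 i)
  thus ?case
    using step[of "z + of_int (i - 1)"] z c
    by (simp add: in_Hplane_iff power_int_diff field_simps)
qed simp

lemma Hplane_neg_inverse: "z \<in> Hplane \<Longrightarrow> - 1 / z \<in> Hplane"
  using mat2_act_in_Hplane[of "(0, -1, 1, 0)" z] by (simp add: mat2_act_def moebius_def det2_def)

section \<open>Partial fractions and double series\<close>

lemma Digamma_reflection:
  fixes z :: complex
  assumes "z \<notin> \<int>"
  shows "Digamma (1 - z) - Digamma z = of_real pi * cot (of_real pi * z)"
proof -
  have z: "z \<notin> \<int>\<^sub>\<le>\<^sub>0" "1 - z \<notin> \<int>\<^sub>\<le>\<^sub>0"
    using assms by (auto dest: nonpos_Ints_Int)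
  hence nonzero: "rGamma z * rGamma (1 - z) \<noteq> 0"
    by (simp add: rGamma_eq_zero_iff)
  have "((\<lambda>z. rGamma z * rGamma (1 - z)) has_field_derivative
      rGamma z * rGamma (1 - z) * (Digamma (1 - z) - Digamma z)) (at z)"
    using z by (auto intro!: derivative_eq_intros has_field_derivative_rGamma_no_nonpos_int
        DERIV_chain2[where f = rGamma] simp: algebra_simps simp del: rGamma_reflection_complex)
  moreover have "((\<lambda>z. sin (of_real pi * z) / of_real pi) has_field_derivative cos (of_real pi * z)) (at z)"
    by (auto intro!: derivative_eq_intros)
  ultimately have "cos (of_real pi * z) = rGamma z * rGamma (1 - z) * (Digamma (1 - z) - Digamma z)"
    unfolding rGamma_reflection_complex by (metis DERIV_unique)
  with nonzero show ?thesis
    unfolding rGamma_reflection_complex by (auto simp: cot_def field_simps)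
qed

lemma pi_cot_partial_fractions:
  fixes z :: complex
  assumes "z \<notin> \<int>"
  shows "(\<lambda>n. 1 / (z + of_nat (Suc n)) + 1 / (z - of_nat (Suc n))) sums
    (of_real pi * cot (of_real pi * z) - 1 / z)"
proof -
  have z: "z \<noteq> 0" "1 + z \<noteq> 0" "1 - z \<noteq> 0"
    using assms by (auto simp: add_eq_0_iff)
  have "(\<lambda>m. (of_real (ln (real m)) - (\<Sum>n<m. inverse (1 - z + of_nat n))) -
      (of_real (ln (real m)) - (\<Sum>n<m. inverse (1 + z + of_nat n)))) \<longlonglongrightarrow> Digamma (1 - z) - Digamma (1 + z)"
    by (intro tendsto_diff Digamma_LIMSEQ z)
  also have "Digamma (1 - z) - Digamma (1 + z) = of_real pi * cot (of_real pi * z) - 1 / z"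
    using Digamma_reflection[OF assms] Digamma_plus1[OF z(1)] by (simp add: add.commute)
  finally have "(\<lambda>n. inverse (1 + z + of_nat n) - inverse (1 - z + of_nat n)) sums
      (of_real pi * cot (of_real pi * z) - 1 / z)"
    by (simp add: sums_def sum_subtractf)
  moreover have "inverse (1 + z + of_nat n) - inverse (1 - z + of_nat n) =
      1 / (z + of_nat (Suc n)) + 1 / (z - of_nat (Suc n))" for n
    using inverse_minus_eq[of "z - of_nat (Suc n)"] by (simp add: inverse_eq_divide algebra_simps)
  ultimately show ?thesis
    by (simp only:)
qed

lemma pi_square_over_sin_square_sums:
  fixes z :: complex
  assumes "z \<notin> \<int>"
  shows "(\<lambda>n. 1 / (z + of_nat (Suc n))\<^sup>2 + 1 / (z - of_nat (Suc n))\<^sup>2) sums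
     (of_real pi ^ 2 / sin (of_real pi * z) ^ 2 - 1 / z ^ 2)"
proof -
  have z: "z \<noteq> 0" "1 + z \<noteq> 0" "1 - z \<noteq> 0" "z \<notin> \<int>\<^sub>\<le>\<^sub>0" "1 - z \<notin> \<int>\<^sub>\<le>\<^sub>0"
    using assms by (auto simp: add_eq_0_iff dest: nonpos_Ints_Int)
  hence sin: "sin (of_real pi * z) \<noteq> 0"
    using rGamma_reflection_complex[of z] by (auto simp: rGamma_eq_zero_iff)
  have "((\<lambda>z. of_real pi * cot (of_real pi * z)) has_field_derivative
      - (of_real pi ^ 2 / sin (of_real pi * z) ^ 2)) (at z)"
    using sin by (auto intro!: derivative_eq_intros DERIV_chain2[OF DERIV_cot]
        simp: divide_simps power2_eq_square)
  hence "((\<lambda>z. Digamma (1 - z) - Digamma z) has_field_derivative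
      - (of_real pi ^ 2 / sin (of_real pi * z) ^ 2)) (at z)"
    by (rule has_field_derivative_transform_within_open[where S = "- \<int>"])
       (use assms in \<open>auto simp: Digamma_reflection closed_Ints open_Compl\<close>)
  moreover have "((\<lambda>z. Digamma (1 - z) - Digamma z) has_field_derivative
      (- Polygamma 1 (1 - z) - Polygamma 1 z)) (at z)"
    using z by (auto intro!: derivative_eq_intros)
  ultimately have "- (of_real pi ^ 2 / sin (of_real pi * z) ^ 2) = - Polygamma 1 (1 - z) - Polygamma 1 z"
    by (rule DERIV_unique)
  hence "Polygamma 1 z + Polygamma 1 (1 - z) = of_real pi ^ 2 / sin (of_real pi * z) ^ 2"
    by (simp add: minus_equation_iff)
  hence limit: "Polygamma 1 (1 + z) + Polygamma 1 (1 - z) =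
      of_real pi ^ 2 / sin (of_real pi * z) ^ 2 - 1 / z ^ 2"
    using Polygamma_plus1[OF z(1), of 1] by (simp add: add.commute power2_eq_square)
  have "(\<lambda>n. inverse ((w + of_nat n)\<^sup>2)) sums Polygamma 1 w" if "w \<noteq> 0" for w :: complex
    using Polygamma_converges'[OF that, of 2] by (simp add: Polygamma_def sums_iff numeral_2_eq_2)
  from sums_add[OF this[OF z(2)] this[OF z(3)]]
  have "(\<lambda>n. inverse ((1 + z + of_nat n)\<^sup>2) + inverse ((1 - z + of_nat n)\<^sup>2)) sums
      (of_real pi ^ 2 / sin (of_real pi * z) ^ 2 - 1 / z ^ 2)"
    by (simp only: limit)
  moreover have "inverse ((1 + z + of_nat n)\<^sup>2) + inverse ((1 - z + of_nat n)\<^sup>2) =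
      1 / (z + of_nat (Suc n))\<^sup>2 + 1 / (z - of_nat (Suc n))\<^sup>2" for n
    using power2_minus[of "z - of_nat (Suc n)"] by (simp add: inverse_eq_divide algebra_simps)
  ultimately show ?thesis
    by (simp only:)
qed

lemma sums_swap:
  fixes F :: "nat \<Rightarrow> nat \<Rightarrow> 'a :: {t3_space, complete_uniform_space, uniform_topological_group_add, ab_group_add, topological_comm_monoid_add}"
  assumes summable: "(\<lambda>(m, n). F m n) summable_on (UNIV \<times> UNIV)"
    and rows: "\<And>m. F m sums r m" and columns: "\<And>n. (\<lambda>m. F m n) sums c n"
    and total: "r sums S"
  shows "c sums S"
proof -
  have has_sum: "(f has_sum s) UNIV" if "f summable_on UNIV" "f sums s" for f :: "nat \<Rightarrow> 'a" and s
    using that has_sum_imp_sums sums_unique2 by (metis summable_on_def)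
  obtain T where T: "((\<lambda>(m, n). F m n) has_sum T) (UNIV \<times> UNIV)"
    using summable by (auto simp: summable_on_def)
  hence T': "((\<lambda>(n, m). F m n) has_sum T) (UNIV \<times> UNIV)"
    by (subst (asm) has_sum_swap) simp
  have "(r has_sum T) UNIV"
    by (rule has_sum_SigmaD[OF T])
       (use summable_on_SigmaD1[OF summable] in \<open>auto intro!: has_sum rows\<close>)
  hence "T = S"
    using total has_sum_imp_sums sums_unique2 by blast
  moreover have "(c has_sum T) UNIV"
    by (rule has_sum_SigmaD[OF T'])
       (use summable_on_SigmaD1[OF has_sum_imp_summable[OF T']] in \<open>auto intro!: has_sum columns\<close>)
  ultimately show ?thesis
    using has_sum_imp_sums by blast
qed

lemma summable_on_times_real:
  fixes f :: "'a \<Rightarrow> real" and g :: "'b \<Rightarrow> real"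
  assumes "f summable_on A" "g summable_on B" "\<And>x. x \<in> A \<Longrightarrow> f x \<ge> 0" "\<And>y. y \<in> B \<Longrightarrow> g y \<ge> 0"
  shows "(\<lambda>(x, y). f x * g y) summable_on (A \<times> B)"
  by (rule summable_on_SigmaI[where g = "\<lambda>x. f x * infsum g B"])
     (use assms in \<open>auto intro!: has_sum_cmult_right summable_on_cmult_left\<close>)

lemma cot_conv_exp: "cot z = \<i> * (1 + exp (- 2 * \<i> * z)) / (1 - exp (- 2 * \<i> * z))"
proof -
  have "exp (- 2 * \<i> * z) = exp (- (\<i> * z)) * exp (- (\<i> * z))"
    by (simp add: mult.assoc flip: exp_add)
  hence "1 + exp (- 2 * \<i> * z) = exp (- (\<i> * z)) * (2 * cos z)"
    "1 - exp (- 2 * \<i> * z) = exp (- (\<i> * z)) * (2 * \<i> * sin z)"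
    by (simp_all add: cos_exp_eq sin_exp_eq field_simps flip: exp_add)
  thus ?thesis
    by (simp add: cot_def)
qed

lemma tendsto_cot_Im_at_bot:
  assumes "filterlim (\<lambda>x. Im (f x)) at_bot F"
  shows "((\<lambda>x. cot (f x)) \<longlongrightarrow> \<i>) F"
proof -
  have "((\<lambda>x. exp (2 * Im (f x))) \<longlongrightarrow> 0) F"
    by (rule filterlim_compose[OF _ assms]) real_asymp
  hence "((\<lambda>x. exp (- 2 * \<i> * f x)) \<longlongrightarrow> 0) F"
    by (rule tendsto_norm_zero_cancel[OF tendsto_cong[THEN iffD1, rotated]]) simp
  hence "((\<lambda>x. \<i> * (1 + exp (- 2 * \<i> * f x)) / (1 - exp (- 2 * \<i> * f x))) \<longlongrightarrow> \<i> * (1 + 0) / (1 - 0)) F"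
    by (intro tendsto_intros) auto
  thus ?thesis
    by (simp add: cot_conv_exp)
qed

lemma lattice_norm_lower_bound:
  fixes z :: complex
  assumes "Im z \<noteq> 0"
  obtains c where "c > 0"
    "\<And>x y :: real. c * \<bar>x\<bar> \<le> norm (of_real x * z + of_real y)"
    "\<And>x y :: real. c * \<bar>y\<bar> \<le> norm (of_real x * z + of_real y)"
proof -
  define K where "K = 1 + norm z / \<bar>Im z\<bar>"
  define c where "c = min \<bar>Im z\<bar> (1 / K)"
  have "K > 0"
    using assms by (auto simp: K_def intro!: add_pos_nonneg)
  hence c: "c > 0" "c \<le> \<bar>Im z\<bar>" "c * K \<le> 1"
    using assms by (auto simp: c_def simp flip: pos_le_divide_eq)
  have Im: "\<bar>x\<bar> * \<bar>Im z\<bar> \<le> norm (of_real x * z + of_real y)" for x y :: real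
    using abs_Im_le_cmod[of "of_real x * z + of_real y"] by (simp add: abs_mult)
  have "\<bar>y\<bar> \<le> norm (of_real x * z + of_real y) * K" for x y :: real
  proof -
    have "\<bar>y\<bar> \<le> norm (of_real x * z + of_real y) + \<bar>x\<bar> * norm z"
      using norm_triangle_ineq4[of "of_real x * z + of_real y" "of_real x * z"] by (simp add: norm_mult)
    also have "\<bar>x\<bar> * norm z = \<bar>x\<bar> * \<bar>Im z\<bar> * (norm z / \<bar>Im z\<bar>)"
      using assms by simp
    also have "\<dots> \<le> norm (of_real x * z + of_real y) * (norm z / \<bar>Im z\<bar>)"
      by (intro mult_right_mono Im) auto
    finally show ?thesis
      by (simp add: K_def algebra_simps)
  qed
  hence "c * \<bar>y\<bar> \<le> (c * K) * norm (of_real x * z + of_real y)" for x y :: real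
    using c(1) by (simp add: mult_left_mono mult.commute mult.left_commute)
  moreover have "(c * K) * norm (of_real x * z + of_real y) \<le> norm (of_real x * z + of_real y)" for x y :: real
    using mult_right_mono[OF c(3) norm_ge_zero] by simp
  moreover have "c * \<bar>x\<bar> \<le> norm (of_real x * z + of_real y)" for x y :: real
    using mult_right_mono[OF c(2) abs_ge_zero[of x]] Im[of x y] by (simp add: mult.commute)
  ultimately show thesis
    using c(1) that by (meson order_trans)
qed

lemma lattice_nonzero:
  fixes z :: complex
  assumes "Im z \<noteq> 0"
  shows "of_nat (Suc m) * z + of_nat n \<noteq> 0" "of_nat (Suc m) * z - of_nat n \<noteq> 0"
  using assms by (auto simp: complex_eq_iff simp del: of_nat_Suc)

definition lattice_term :: "complex \<Rightarrow> nat \<Rightarrow> nat \<Rightarrow> complex" where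
  "lattice_term z m n =
     1 / (of_nat (Suc m) * z + of_nat (Suc n))\<^sup>2 + 1 / (of_nat (Suc m) * z - of_nat (Suc n))\<^sup>2"

text \<open>
  The double series over \<^const>\<open>lattice_term\<close> converges only conditionally.  Subtracting the increments
  in \<open>n\<close> of the following function makes it absolutely convergent; they sum to \<open>0\<close> over \<open>n\<close>, but
  summing over \<open>m\<close> first leaves the limit of a cotangent.
\<close>

definition lattice_correction :: "complex \<Rightarrow> nat \<Rightarrow> nat \<Rightarrow> complex" where
  "lattice_correction z m n = 1 / (of_nat (Suc m) * z - of_nat n) - 1 / (of_nat (Suc m) * z + of_nat n)"

definition corrected_term :: "complex \<Rightarrow> nat \<Rightarrow> nat \<Rightarrow> complex" where
  "corrected_term z m n =
     lattice_term z m n - (lattice_correction z m (Suc n) - lattice_correction z m n)"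

lemma corrected_term_eq:
  assumes "Im z \<noteq> 0"
  shows "corrected_term z m n =
    1 / ((of_nat (Suc m) * z - of_nat (Suc n))\<^sup>2 * (of_nat (Suc m) * z - of_nat n)) -
    1 / ((of_nat (Suc m) * z + of_nat (Suc n))\<^sup>2 * (of_nat (Suc m) * z + of_nat n))"
proof -
  define w where "w = of_nat (Suc m) * z"
  have identity: "1 / x\<^sup>2 + 1 / y\<^sup>2 - ((1 / y - 1 / x) - (1 / (y + 1) - 1 / (x - 1))) =
      1 / (y\<^sup>2 * (y + 1)) - 1 / (x\<^sup>2 * (x - 1))"
    if "x \<noteq> 0" "y \<noteq> 0" "x - 1 \<noteq> 0" "y + 1 \<noteq> 0" for x y :: complex
  proof -
    have "1 / x\<^sup>2 + 1 / x - 1 / (x - 1) = - (1 / (x\<^sup>2 * (x - 1)))"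
      using that by (simp add: divide_simps) (simp add: algebra_simps power2_eq_square)
    moreover have "1 / y\<^sup>2 - 1 / y + 1 / (y + 1) = 1 / (y\<^sup>2 * (y + 1))"
      using that by (simp add: divide_simps) (simp add: algebra_simps power2_eq_square)
    ultimately show ?thesis
      by (simp add: algebra_simps)
  qed
  have "w + of_nat (Suc n) - 1 = w + of_nat n" "w - of_nat (Suc n) + 1 = w - of_nat n"
    by simp_all
  with identity[of "w + of_nat (Suc n)" "w - of_nat (Suc n)"] show ?thesis
    using lattice_nonzero[OF assms, of m] unfolding corrected_term_def lattice_term_def lattice_correction_def w_def
    by (simp only: not_False_eq_True simp_thms)
qed

lemma inverse_cubic_le_powr:
  fixes c M N x y :: real
  assumes pos: "c > 0" "M > 0" "N > 0" and x: "c * M \<le> x" "c * N \<le> x" and y: "c * M \<le> y"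
  shows "1 / (x\<^sup>2 * y) \<le> 1 / c ^ 3 * (M powr (-3/2) * N powr (-3/2))"
proof -
  have pos': "0 < c * M" "0 < c * N"
    using pos by auto
  hence "x > 0" "y > 0"
    using x(1) y by linarith+
  have "((M * N) powr (3/2))\<^sup>2 = (M * N) ^ 3"
    using pos powr_add[of "M * N" "3/2" "3/2"] by (simp add: power2_eq_square)
  hence "(c ^ 3 * (M * N) powr (3/2))\<^sup>2 = (c * M) * (c * N) ^ 3 * (c * M)\<^sup>2"
    by (simp add: power_mult_distrib power2_eq_square power3_eq_cube algebra_simps)
  also have "\<dots> \<le> x * x ^ 3 * y\<^sup>2"
    using x y pos' \<open>x > 0\<close> by (intro mult_mono power_mono) auto
  also have "\<dots> = (x\<^sup>2 * y)\<^sup>2"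
    by (simp add: power2_eq_square power3_eq_cube algebra_simps)
  finally have "c ^ 3 * (M * N) powr (3/2) \<le> x\<^sup>2 * y"
    by (rule power2_le_imp_le) (use \<open>x > 0\<close> \<open>y > 0\<close> in simp)
  hence "inverse (x\<^sup>2 * y) \<le> inverse (c ^ 3 * (M * N) powr (3/2))"
    using pos by (intro le_imp_inverse_le) auto
  thus ?thesis
    using pos by (simp add: powr_mult powr_minus field_simps)
qed

lemma summable_on_corrected_term:
  assumes z: "Im z \<noteq> 0"
  shows "(\<lambda>(m, n). corrected_term z m n) summable_on (UNIV \<times> UNIV)"
proof -
  obtain c where c: "c > 0" "\<And>x y :: real. c * \<bar>x\<bar> \<le> norm (of_real x * z + of_real y)"
    "\<And>x y :: real. c * \<bar>y\<bar> \<le> norm (of_real x * z + of_real y)"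
    using lattice_norm_lower_bound[OF z] by blast
  define b where "b = (\<lambda>n. real (Suc n) powr (-3/2))"
  have "summable b"
    unfolding b_def by (subst summable_Suc_iff[of "\<lambda>n. real n powr (-3/2)"]) (simp add: summable_real_powr_iff)
  hence "b summable_on UNIV"
    by (rule summable_nonneg_imp_summable_on) (simp add: b_def)
  hence "(\<lambda>(m, n). b m * b n) summable_on (UNIV \<times> UNIV)"
    by (intro summable_on_times_real) (auto simp: b_def)
  hence majorant: "(\<lambda>p. 2 / c ^ 3 * (case p of (m, n) \<Rightarrow> b m * b n)) summable_on (UNIV \<times> UNIV)"
    by (rule summable_on_cmult_right)
  have bound: "norm (1 / ((of_real M * z + of_real x)\<^sup>2 * (of_real M * z + of_real y))) \<le>
      1 / c ^ 3 * (M powr (-3/2) * N powr (-3/2))"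
    if "M > 0" "N > 0" "\<bar>x\<bar> = N" for M N x y :: real
    unfolding norm_divide norm_mult norm_power norm_one
    using c(1) c(2)[of M x] c(3)[where x = M and y = x] c(2)[of M y] that
    by (intro inverse_cubic_le_powr) auto
  have "norm (corrected_term z m n) \<le> 2 / c ^ 3 * (b m * b n)" for m n
  proof -
    have "norm (corrected_term z m n) \<le> 1 / c ^ 3 * (b m * b n) + 1 / c ^ 3 * (b m * b n)"
      unfolding corrected_term_eq[OF z] b_def
      using bound[of "real (Suc m)" "real (Suc n)" "- real (Suc n)" "- real n"]
        bound[of "real (Suc m)" "real (Suc n)" "real (Suc n)" "real n"]
      by (intro order.trans[OF norm_triangle_ineq4] add_mono) (simp_all del: of_nat_Suc)
    thus ?thesis
      by simp
  qed
  hence "(\<lambda>x. norm (case x of (m, n) \<Rightarrow> corrected_term z m n)) summable_on (UNIV \<times> UNIV)"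
    by (intro Infinite_Sum.abs_summable_on_comparison_test'[OF majorant]) auto
  thus ?thesis
    by (rule abs_summable_summable)
qed

lemma lattice_correction_tendsto_0: "lattice_correction z m \<longlonglongrightarrow> 0"
proof -
  have "filterlim (\<lambda>n. of_nat n - of_nat (Suc m) * z :: complex) at_infinity sequentially"
    "filterlim (\<lambda>n. of_nat (Suc m) * z + of_nat n :: complex) at_infinity sequentially"
    using tendsto_add_filterlim_at_infinity'[OF tendsto_of_nat tendsto_const, of "- (of_nat (Suc m) * z)"]
      tendsto_add_filterlim_at_infinity[OF tendsto_const tendsto_of_nat]
    by simp_all
  hence "(\<lambda>n. - 1 / (of_nat n - of_nat (Suc m) * z) - 1 / (of_nat (Suc m) * z + of_nat n)) \<longlonglongrightarrow> 0 - 0"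
    by (intro tendsto_diff tendsto_divide_0[OF tendsto_const])
  moreover have "lattice_correction z m =
      (\<lambda>n. - 1 / (of_nat n - of_nat (Suc m) * z) - 1 / (of_nat (Suc m) * z + of_nat n))"
    using minus_divide_right[of 1 "of_nat _ - of_nat (Suc m) * z"]
    by (simp add: fun_eq_iff lattice_correction_def del: of_nat_Suc)
  ultimately show ?thesis
    by simp
qed

lemma of_nat_divide_notin_Ints:
  fixes z :: complex
  assumes z: "Im z \<noteq> 0" and n: "n > 0"
  shows "of_nat n / z \<notin> \<int>"
proof
  assume "of_nat n / z \<in> \<int>"
  then obtain k where "of_nat n / z = of_int k"
    by (auto elim: Ints_cases)
  moreover have "z \<noteq> 0"
    using z by auto
  ultimately have "of_nat n = of_int k * z"
    by (simp add: field_simps)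
  thus False
    using assms by (auto simp: complex_eq_iff)
qed

text \<open>At \<open>n = 0\<close> the limit is \<open>0\<close>, by the conventions \<open>x / 0 = 0\<close> and \<open>cot 0 = 0\<close>.\<close>

lemma lattice_correction_sums:
  assumes z: "Im z \<noteq> 0"
  shows "(\<lambda>m. lattice_correction z m n) sums ((z / of_nat n - of_real pi * cot (of_real pi * (of_nat n / z))) / z)"
proof (cases "n = 0")
  case True
  thus ?thesis
    by (simp add: lattice_correction_def cot_def)
next
  case False
  have z0: "z \<noteq> 0"
    using z by auto
  define w where "w = of_nat n / z"
  from sums_mult[OF pi_cot_partial_fractions[OF of_nat_divide_notin_Ints[OF z, of n]], of "- 1 / z"] False
  have "(\<lambda>m. - 1 / z * (1 / (w + of_nat (Suc m)) + 1 / (w - of_nat (Suc m)))) sums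
      (- 1 / z * (of_real pi * cot (of_real pi * w) - 1 / w))"
    by (simp add: w_def)
  also have "- 1 / z * (of_real pi * cot (of_real pi * w) - 1 / w) =
      (z / of_nat n - of_real pi * cot (of_real pi * w)) / z"
    by (simp add: w_def diff_divide_distrib)
  finally have "(\<lambda>m. - 1 / z * (1 / (w + of_nat (Suc m)) + 1 / (w - of_nat (Suc m)))) sums
      ((z / of_nat n - of_real pi * cot (of_real pi * w)) / z)" .
  moreover have "- 1 / z * (1 / (w + of_nat (Suc m)) + 1 / (w - of_nat (Suc m))) = lattice_correction z m n" for m
  proof -
    have "z * (w + of_nat (Suc m)) = of_nat (Suc m) * z + of_nat n"
      "z * (w - of_nat (Suc m)) = - (of_nat (Suc m) * z - of_nat n)"
      using z0 by (simp_all add: w_def algebra_simps)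
    hence "- (1 / (z * (w + of_nat (Suc m)))) - 1 / (z * (w - of_nat (Suc m))) = lattice_correction z m n"
      by (simp only: lattice_correction_def divide_minus_right) simp
    thus ?thesis
      by (simp add: distrib_left)
  qed
  ultimately show ?thesis
    by (simp add: w_def)
qed

lemma lattice_correction_sum_tendsto:
  assumes z: "Im z > 0"
  shows "(\<lambda>n. (z / of_nat n - of_real pi * cot (of_real pi * (of_nat n / z))) / z) \<longlonglongrightarrow> - of_real pi * \<i> / z"
proof -
  have "Im (of_real pi * (of_nat n / z)) = - (pi * Im z / (norm z)\<^sup>2) * real n" for n
    by (simp add: Im_divide cmod_power2)
  moreover have "pi * Im z / (norm z)\<^sup>2 > 0"
    using z by (auto intro!: divide_pos_pos mult_pos_pos)
  ultimately have "filterlim (\<lambda>n. Im (of_real pi * (of_nat n / z))) at_bot sequentially"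
    by (simp only:) real_asymp
  hence "(\<lambda>n. (z / of_nat n - of_real pi * cot (of_real pi * (of_nat n / z))) / z) \<longlonglongrightarrow> (0 - of_real pi * \<i>) / z"
    using z by (intro tendsto_intros tendsto_cot_Im_at_bot tendsto_divide_0[OF tendsto_const] tendsto_of_nat) auto
  thus ?thesis
    by simp
qed

lemma lattice_double_series_swap:
  assumes z: "Im z > 0"
    and rows: "\<And>m. (\<lambda>n. lattice_term z m n) sums r m"
    and columns: "\<And>n. (\<lambda>m. lattice_term z m n) sums c n"
    and total: "r sums S"
  shows "c sums (S - of_real pi * \<i> / z)"
proof -
  define G where "G = (\<lambda>n. (z / of_nat n - of_real pi * cot (of_real pi * (of_nat n / z))) / z)"
  have z': "Im z \<noteq> 0"
    using z by simp
  have row_corrections: "(\<lambda>n. lattice_correction z m (Suc n) - lattice_correction z m n) sums 0" for m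
    using telescope_sums[OF lattice_correction_tendsto_0, of z m] by (simp add: lattice_correction_def)
  have column_corrections: "(\<lambda>m. lattice_correction z m (Suc n) - lattice_correction z m n) sums (G (Suc n) - G n)" for n
    unfolding G_def by (intro sums_diff lattice_correction_sums z')
  have "(\<lambda>n. c n - (G (Suc n) - G n)) sums S"
  proof (rule sums_swap[OF summable_on_corrected_term[OF z'] _ _ total])
    have "(\<lambda>n. corrected_term z m n) sums r m" for m
      using sums_diff[OF rows[of m] row_corrections[of m]] by (simp add: corrected_term_def)
    thus "corrected_term z m sums r m" for m .
    show "(\<lambda>m. corrected_term z m n) sums (c n - (G (Suc n) - G n))" for n
      using sums_diff[OF columns[of n] column_corrections[of n]] by (simp add: corrected_term_def)
  qed
  moreover have "(\<lambda>n. G (Suc n) - G n) sums (- of_real pi * \<i> / z - G 0)"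
    unfolding G_def by (rule telescope_sums[OF lattice_correction_sum_tendsto[OF z]])
  ultimately have "c sums (S + (- of_real pi * \<i> / z - G 0))"
    using sums_add by fastforce
  thus ?thesis
    by (simp add: G_def cot_def)
qed

lemma inverse_sin_square_conv_exp:
  "1 / sin z ^ 2 = - 4 * exp (2 * \<i> * z) / (1 - exp (2 * \<i> * z)) ^ 2" for z :: complex
proof -
  have "exp (2 * \<i> * z) = exp (\<i> * z) ^ 2"
    by (simp add: exp_double mult.assoc)
  moreover from this have "1 - exp (2 * \<i> * z) = - 2 * \<i> * exp (\<i> * z) * sin z"
    by (simp add: sin_exp_eq exp_minus power2_eq_square field_simps)
  ultimately show ?thesis
    by (simp add: power_mult_distrib)
qed

definition lattice_row :: "complex \<Rightarrow> nat \<Rightarrow> complex" where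
  "lattice_row z m =
     of_real pi ^ 2 / sin (of_real pi * (of_nat (Suc m) * z)) ^ 2 - 1 / (of_nat (Suc m) * z) ^ 2"

lemma lattice_row_sums:
  assumes "Im z \<noteq> 0"
  shows "(\<lambda>n. lattice_term z m n) sums lattice_row z m"
proof -
  have "of_nat (Suc m) * z \<notin> \<int>"
    using assms by (auto elim!: Ints_cases simp: complex_eq_iff simp del: of_nat_Suc)
  from pi_square_over_sin_square_sums[OF this] show ?thesis
    unfolding lattice_term_def lattice_row_def .
qed

lemma lattice_term_neg_inverse:
  assumes "z \<noteq> 0"
  shows "lattice_term (- 1 / z) n m / z\<^sup>2 = lattice_term z m n"
proof -
  have "of_nat (Suc n) * (- 1 / z) + of_nat (Suc m) = (of_nat (Suc m) * z - of_nat (Suc n)) / z"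
    "of_nat (Suc n) * (- 1 / z) - of_nat (Suc m) = - (of_nat (Suc m) * z + of_nat (Suc n)) / z"
    using assms by (simp_all add: field_simps del: of_nat_Suc)
  thus ?thesis
    using assms by (simp only: lattice_term_def power_divide power2_minus) (simp add: add_divide_distrib)
qed

section \<open>The eta function under inversion\<close>

definition euler_phi :: "complex \<Rightarrow> complex" where
  "euler_phi x = prodinf (\<lambda>n. 1 - x ^ Suc n)"

lemma euler_phi_0: "euler_phi 0 = 1"
  by (simp add: euler_phi_def)

lemma norm_power_Suc_less_one: "norm (x :: complex) < 1 \<Longrightarrow> norm (x ^ Suc n) < 1"
  by (metis norm_ge_zero norm_power power_less_one_iff zero_less_Suc)

lemma one_minus_power_Suc_nonzero: "norm (x :: complex) < 1 \<Longrightarrow> 1 - x ^ Suc n \<noteq> 0"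
  using norm_power_Suc_less_one[of x n] by auto

lemma euler_phi_convergent:
  fixes x :: complex
  assumes "norm x < 1"
  shows "convergent_prod (\<lambda>n. 1 - x ^ Suc n)"
proof -
  have "summable (\<lambda>n. norm (- (x ^ Suc n)))"
    using assms by (simp add: norm_mult norm_power summable_mult summable_geometric)
  from summable_imp_convergent_prod_complex[OF this] one_minus_power_Suc_nonzero[OF assms]
  show ?thesis
    by simp
qed

lemma euler_phi_nonzero:
  assumes "norm x < 1"
  shows "euler_phi x \<noteq> 0"
  unfolding euler_phi_def
  by (rule prodinf_nonzero[OF euler_phi_convergent[OF assms] one_minus_power_Suc_nonzero[OF assms]])

lemma euler_phi_uniform_limit:
  assumes "r < 1"
  shows "uniform_limit (cball 0 r) (\<lambda>N x. \<Prod>n<N. 1 - x ^ Suc n) euler_phi sequentially"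
proof -
  have "uniformly_convergent_on (cball 0 r) (\<lambda>N x. \<Sum>n<N. norm ((1 - x ^ Suc n) - 1 :: complex))"
  proof (cases "r \<ge> 0")
    case True
    show ?thesis
    proof (rule Weierstrass_m_test')
      show "summable (\<lambda>n. r ^ Suc n)"
        using assms True by (simp add: summable_mult summable_geometric)
      show "norm (norm ((1 - x ^ Suc n) - 1)) \<le> r ^ Suc n" if "x \<in> cball 0 r" for n and x :: complex
        using that power_mono[of "norm x" r "Suc n"] by (simp add: norm_power norm_mult)
    qed
  qed (simp add: uniformly_convergent_on_def)
  hence "uniformly_convergent_on (cball 0 r) (\<lambda>N x. \<Prod>n<N. 1 - x ^ Suc n :: complex)"
    by (intro uniformly_convergent_on_prod') (auto intro!: continuous_intros)
  then obtain P where P: "uniform_limit (cball 0 r) (\<lambda>N x. \<Prod>n<N. 1 - x ^ Suc n :: complex) P sequentially"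
    by (auto simp: uniformly_convergent_on_def)
  have "P x = euler_phi x" if "x \<in> cball 0 r" for x
  proof (rule LIMSEQ_unique)
    show "(\<lambda>N. \<Prod>n<N. 1 - x ^ Suc n) \<longlonglongrightarrow> P x"
      using tendsto_uniform_limitI[OF P that] .
    show "(\<lambda>N. \<Prod>n<N. 1 - x ^ Suc n) \<longlonglongrightarrow> euler_phi x"
      using convergent_prod_LIMSEQ[OF euler_phi_convergent[of x]] that assms
      by (simp add: euler_phi_def LIMSEQ_lessThan_iff_atMost)
  qed
  with P show ?thesis
    by (subst (asm) uniform_limit_cong') auto
qed

lemma euler_phi_holomorphic: "euler_phi holomorphic_on ball 0 1"
proof (rule holomorphic_uniform_sequence)
  show "(\<lambda>x. \<Prod>n<N. 1 - x ^ Suc n) holomorphic_on ball 0 1" for N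
    by (intro holomorphic_intros)
  fix x :: complex assume "x \<in> ball 0 1"
  hence "cball x ((1 - norm x) / 2) \<subseteq> cball 0 ((1 + norm x) / 2)" "0 < (1 - norm x) / 2" "(1 + norm x) / 2 < 1"
    by (auto simp: cball_subset_cball_iff dist_norm field_simps)
  moreover from this have "cball x ((1 - norm x) / 2) \<subseteq> ball 0 1"
    by (auto simp: subset_iff)
  ultimately show "\<exists>d>0. cball x d \<subseteq> ball 0 1 \<and>
      uniform_limit (cball x d) (\<lambda>N x. \<Prod>n<N. 1 - x ^ Suc n) euler_phi sequentially"
    using uniform_limit_on_subset[OF euler_phi_uniform_limit] by blast
qed auto

lemma euler_phi_logderiv_sums:
  assumes "norm x < 1"
  shows "(\<lambda>n. of_nat (Suc n) * x ^ Suc n / (1 - x ^ Suc n)) sums (- x * (deriv euler_phi x / euler_phi x))"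
proof -
  define r where "r = (1 + norm x) / 2"
  have r: "x \<in> ball 0 r" "r < 1"
    using assms by (auto simp: r_def)
  have "(\<lambda>n. deriv (\<lambda>x. 1 - x ^ Suc n) x / (1 - x ^ Suc n)) sums (deriv euler_phi x / euler_phi x)"
  proof (rule logderiv_prodinf_complex_uniform_limit)
    show "uniform_limit (ball 0 r) (\<lambda>N x. \<Prod>n<N. 1 - x ^ Suc n) euler_phi sequentially"
      using uniform_limit_on_subset[OF euler_phi_uniform_limit[OF r(2)] ball_subset_cball] .
  qed (use r euler_phi_nonzero[OF assms] in \<open>auto intro!: holomorphic_intros\<close>)
  moreover have "deriv (\<lambda>x. 1 - x ^ Suc n) x = - (of_nat (Suc n) * x ^ n)" for n
    by (rule DERIV_imp_deriv) (auto intro!: derivative_eq_intros simp del: power_Suc of_nat_Suc)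
  ultimately have "(\<lambda>n. - (of_nat (Suc n) * x ^ n) / (1 - x ^ Suc n)) sums (deriv euler_phi x / euler_phi x)"
    by (simp only:)
  from sums_mult[OF this, of "- x"] show ?thesis
    by (simp add: mult_ac del: of_nat_Suc)
qed

lemma Lambert_series_swap:
  fixes x :: complex
  assumes x: "norm x < 1" and S: "(\<lambda>n. of_nat (Suc n) * x ^ Suc n / (1 - x ^ Suc n)) sums S"
  shows "(\<lambda>k. x ^ Suc k / (1 - x ^ Suc k)\<^sup>2) sums S"
proof (rule sums_swap[OF _ _ _ S])
  have "summable (\<lambda>n. real (Suc n) * norm x ^ n)" "summable (\<lambda>n. norm x ^ n)"
    using x geometric_deriv_sums[of "norm x"] by (auto simp: sums_iff summable_geometric)
  hence majorant: "(\<lambda>(n, k). real (Suc n) * norm x ^ n * norm x ^ k) summable_on (UNIV \<times> UNIV)"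
    by (intro summable_on_times_real summable_nonneg_imp_summable_on) auto
  show "(\<lambda>(n, k). of_nat (Suc n) * x ^ (Suc n * Suc k)) summable_on (UNIV \<times> UNIV)"
  proof (rule abs_summable_summable[OF Infinite_Sum.abs_summable_on_comparison_test'[OF majorant]])
    fix p :: "nat \<times> nat"
    obtain n k where p: "p = (n, k)"
      by (cases p)
    have "norm x ^ (Suc n * Suc k) \<le> norm x ^ (n + k)"
      using x by (intro power_decreasing) auto
    hence "real (Suc n) * norm x ^ (Suc n * Suc k) \<le> real (Suc n) * (norm x ^ n * norm x ^ k)"
      by (intro mult_left_mono) (simp_all add: power_add del: mult_Suc mult_Suc_right)
    thus "norm (case p of (n, k) \<Rightarrow> of_nat (Suc n) * x ^ (Suc n * Suc k)) \<le>
        (case p of (n, k) \<Rightarrow> real (Suc n) * norm x ^ n * norm x ^ k)"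
      by (simp add: p norm_mult norm_power mult.assoc del: of_nat_Suc mult_Suc mult_Suc_right)
  qed
  have geometric: "(\<lambda>k. y ^ Suc k) sums (y / (1 - y))" if "norm y < 1" for y :: complex
    using sums_mult[OF geometric_sums[OF that], of y] by simp
  show "(\<lambda>k. of_nat (Suc n) * x ^ (Suc n * Suc k)) sums (of_nat (Suc n) * x ^ Suc n / (1 - x ^ Suc n))" for n
    using sums_mult[OF geometric[OF norm_power_Suc_less_one[OF x, of n]], of "of_nat (Suc n)"]
    by (simp only: power_mult times_divide_eq_right)
  show "(\<lambda>n. of_nat (Suc n) * x ^ (Suc n * Suc k)) sums (x ^ Suc k / (1 - x ^ Suc k)\<^sup>2)" for k
  proof -
    have "of_nat (Suc n) * x ^ (Suc n * Suc k) = x ^ Suc k * (of_nat (Suc n) * (x ^ Suc k) ^ n)" for n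
      by (simp only: mult.commute[of "Suc n" "Suc k"] power_mult power_Suc[of "x ^ Suc k" n] mult_ac)
    thus ?thesis
      using sums_mult[OF geometric_deriv_sums[OF norm_power_Suc_less_one[OF x, of k]], of "x ^ Suc k"]
      by (simp only: times_divide_eq_right mult_1_right)
  qed
qed

abbreviation nome :: "complex \<Rightarrow> complex" where
  "nome z \<equiv> exp (2 * of_real pi * \<i> * z)"

lemma norm_nome_less_one: "z \<in> Hplane \<Longrightarrow> norm (nome z) < 1"
  by (simp add: in_Hplane_iff mult_pos_pos)

lemma eta_conv_euler_phi: "eta z = exp (2 * of_real pi * \<i> * z / 24) * euler_phi (nome z)"
  by (simp add: eta_def euler_phi_def)

lemma eta_nonzero: "z \<in> Hplane \<Longrightarrow> eta z \<noteq> 0"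
  unfolding eta_conv_euler_phi using euler_phi_nonzero[OF norm_nome_less_one] by simp

definition eta_logderiv :: "complex \<Rightarrow> complex" where
  "eta_logderiv z = 2 * of_real pi * \<i> * (1 / 24 + nome z * (deriv euler_phi (nome z) / euler_phi (nome z)))"

lemma has_field_derivative_eta:
  assumes "z \<in> Hplane"
  shows "(eta has_field_derivative eta z * eta_logderiv z) (at z)"
proof -
  have prefactor: "((\<lambda>z. exp (2 * of_real pi * \<i> * z / 24)) has_field_derivative
      exp (2 * of_real pi * \<i> * z / 24) * (2 * of_real pi * \<i> / 24)) (at z)"
    by (rule derivative_eq_intros refl | simp)+
  have "(euler_phi has_field_derivative deriv euler_phi (nome z)) (at (nome z))"
    using norm_nome_less_one[OF assms] by (intro holomorphic_derivI[OF euler_phi_holomorphic]) auto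
  moreover have "(nome has_field_derivative nome z * (2 * of_real pi * \<i>)) (at z)"
    by (auto intro!: derivative_eq_intros)
  ultimately have "((\<lambda>z. euler_phi (nome z)) has_field_derivative
      deriv euler_phi (nome z) * (nome z * (2 * of_real pi * \<i>))) (at z)"
    by (rule DERIV_chain2)
  from DERIV_mult[OF prefactor this]
  have "((\<lambda>z. exp (2 * of_real pi * \<i> * z / 24) * euler_phi (nome z)) has_field_derivative
      exp (2 * of_real pi * \<i> * z / 24) * (2 * of_real pi * \<i> / 24) * euler_phi (nome z) +
      deriv euler_phi (nome z) * (nome z * (2 * of_real pi * \<i>)) * exp (2 * of_real pi * \<i> * z / 24)) (at z)" .
  also have "exp (2 * of_real pi * \<i> * z / 24) * (2 * of_real pi * \<i> / 24) * euler_phi (nome z) +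
      deriv euler_phi (nome z) * (nome z * (2 * of_real pi * \<i>)) * exp (2 * of_real pi * \<i> * z / 24) =
      eta z * eta_logderiv z"
    using euler_phi_nonzero[OF norm_nome_less_one[OF assms]]
    by (simp add: eta_conv_euler_phi eta_logderiv_def field_simps)
  finally show ?thesis
    by (simp add: eta_conv_euler_phi[abs_def])
qed

lemma eta_holomorphic: "eta holomorphic_on Hplane"
  using has_field_derivative_eta by (auto simp: holomorphic_on_open[OF open_Hplane])

lemma lattice_rows_sum:
  assumes z: "z \<in> Hplane"
  shows "lattice_row z sums (- 2 * of_real pi * \<i> * eta_logderiv z - of_real pi ^ 2 / 6 - of_real pi ^ 2 / 6 / z\<^sup>2)"
proof -
  define q where "q = nome z"
  have "(\<lambda>m. q ^ Suc m / (1 - q ^ Suc m)\<^sup>2) sums (- q * (deriv euler_phi q / euler_phi q))"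
    using norm_nome_less_one[OF z] unfolding q_def by (intro Lambert_series_swap euler_phi_logderiv_sums)
  hence "(\<lambda>m. - 4 * of_real pi ^ 2 * (q ^ Suc m / (1 - q ^ Suc m)\<^sup>2)) sums
      (- 4 * of_real pi ^ 2 * (- q * (deriv euler_phi q / euler_phi q)))"
    by (rule sums_mult)
  also have "(\<lambda>m. - 4 * of_real pi ^ 2 * (q ^ Suc m / (1 - q ^ Suc m)\<^sup>2)) =
      (\<lambda>m. of_real pi ^ 2 / sin (of_real pi * (of_nat (Suc m) * z)) ^ 2)"
  proof
    fix m
    have "q ^ Suc m = exp (2 * \<i> * (of_real pi * (of_nat (Suc m) * z)))"
      unfolding q_def exp_of_nat_mult[symmetric] by (simp add: algebra_simps)
    thus "- 4 * of_real pi ^ 2 * (q ^ Suc m / (1 - q ^ Suc m)\<^sup>2) =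
        of_real pi ^ 2 / sin (of_real pi * (of_nat (Suc m) * z)) ^ 2"
      using inverse_sin_square_conv_exp[of "of_real pi * (of_nat (Suc m) * z)"]
      by (simp add: divide_inverse del: power_Suc of_nat_Suc)
  qed
  also have "- 4 * of_real pi ^ 2 * (- q * (deriv euler_phi q / euler_phi q)) =
      - 2 * of_real pi * \<i> * eta_logderiv z - of_real pi ^ 2 / 6"
    by (simp add: eta_logderiv_def q_def algebra_simps power2_eq_square)
  finally have trig: "(\<lambda>m. of_real pi ^ 2 / sin (of_real pi * (of_nat (Suc m) * z)) ^ 2) sums
      (- 2 * of_real pi * \<i> * eta_logderiv z - of_real pi ^ 2 / 6)" .
  have "(\<lambda>n. of_real (1 / (real n + 1)\<^sup>2) :: complex) sums of_real (pi\<^sup>2 / 6)"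
    using inverse_squares_sums by (simp only: sums_of_real_iff) (simp add: add.commute)
  hence "(\<lambda>m. 1 / (of_nat (Suc m))\<^sup>2 / z\<^sup>2) sums (of_real pi ^ 2 / 6 / z\<^sup>2)"
    by (intro sums_divide) (simp add: add.commute)
  from sums_diff[OF trig this] show ?thesis
    by (simp add: lattice_row_def[abs_def] power_mult_distrib)
qed

lemma eta_logderiv_neg_inverse:
  assumes z: "z \<in> Hplane"
  shows "eta_logderiv (- 1 / z) = z\<^sup>2 * eta_logderiv z + z / 2"
proof -
  have z0: "z \<noteq> 0" and z': "- 1 / z \<in> Hplane" and Im: "Im z > 0" "Im (- 1 / z) \<noteq> 0"
    using z Hplane_nonzero[OF z] Hplane_neg_inverse[OF z] unfolding in_Hplane_iff by linarith+
  have "(\<lambda>n. lattice_row (- 1 / z) n / z\<^sup>2) sums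
      (- 2 * of_real pi * \<i> * eta_logderiv z - of_real pi ^ 2 / 6 - of_real pi ^ 2 / 6 / z\<^sup>2 - of_real pi * \<i> / z)"
  proof (rule lattice_double_series_swap[OF Im(1)])
    show "(\<lambda>n. lattice_term z m n) sums lattice_row z m" for m
      using Im(1) by (intro lattice_row_sums) simp
    show "(\<lambda>m. lattice_term z m n) sums (lattice_row (- 1 / z) n / z\<^sup>2)" for n
      using sums_divide[OF lattice_row_sums[OF Im(2)], of n "z\<^sup>2"] by (simp only: lattice_term_neg_inverse[OF z0])
  qed (rule lattice_rows_sum[OF z])
  moreover note sums_divide[OF lattice_rows_sum[OF z'], of "z\<^sup>2"]
  ultimately have "- 2 * of_real pi * \<i> * eta_logderiv z - of_real pi ^ 2 / 6 - of_real pi ^ 2 / 6 / z\<^sup>2 - of_real pi * \<i> / z =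
      (- 2 * of_real pi * \<i> * eta_logderiv (- 1 / z) - of_real pi ^ 2 / 6 - of_real pi ^ 2 / 6 / (- 1 / z)\<^sup>2) / z\<^sup>2"
    by (rule sums_unique2)
  hence "- 2 * of_real pi * \<i> * eta_logderiv (- 1 / z) - of_real pi ^ 2 / 6 - of_real pi ^ 2 / 6 * z\<^sup>2 =
      (- 2 * of_real pi * \<i> * eta_logderiv z - of_real pi ^ 2 / 6 - of_real pi ^ 2 / 6 / z\<^sup>2 - of_real pi * \<i> / z) * z\<^sup>2"
    using z0 by (simp add: power_divide)
  also have "\<dots> = - 2 * of_real pi * \<i> * (z\<^sup>2 * eta_logderiv z + z / 2) - of_real pi ^ 2 / 6 - of_real pi ^ 2 / 6 * z\<^sup>2"
    using z0 by (simp add: algebra_simps power2_eq_square)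
  finally have "2 * of_real pi * \<i> * eta_logderiv (- 1 / z) = 2 * of_real pi * \<i> * (z\<^sup>2 * eta_logderiv z + z / 2)"
    by simp
  thus ?thesis
    by simp
qed

lemma DERIV_divide_same_logderiv:
  fixes f g :: "'a :: real_normed_field \<Rightarrow> 'a"
  assumes "(f has_field_derivative f z * l) (at z)" "(g has_field_derivative g z * l) (at z)" "g z \<noteq> 0"
  shows "((\<lambda>z. f z / g z) has_field_derivative 0) (at z)"
  using DERIV_divide[OF assms] by (simp add: mult_ac)

lemma eta_square_neg_inverse:
  assumes z: "z \<in> Hplane"
  shows "eta (- 1 / z) ^ 2 = - \<i> * z * eta z ^ 2"
proof -
  define K where "K = (\<lambda>z. eta (- 1 / z) ^ 2 / (z * eta z ^ 2))"
  have "(K has_field_derivative 0) (at w)" if w: "w \<in> Hplane" for w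
    unfolding K_def
  proof (rule DERIV_divide_same_logderiv)
    have w0: "w \<noteq> 0"
      using Hplane_nonzero[OF w] .
    have "((\<lambda>w. - 1 / w) has_field_derivative 1 / w\<^sup>2) (at w)"
      using w0 by (auto intro!: derivative_eq_intros simp: power2_eq_square)
    from DERIV_power[OF DERIV_chain2[OF has_field_derivative_eta[OF Hplane_neg_inverse[OF w]] this], of 2]
    show "((\<lambda>z. eta (- 1 / z) ^ 2) has_field_derivative
        eta (- 1 / w) ^ 2 * (2 * eta_logderiv w + 1 / w)) (at w)"
      unfolding eta_logderiv_neg_inverse[OF w]
      by (rule DERIV_cong) (use w0 in \<open>simp add: field_simps power2_eq_square\<close>)
    from DERIV_mult[OF DERIV_ident DERIV_power[OF has_field_derivative_eta[OF w], of 2]]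
    show "((\<lambda>z. z * eta z ^ 2) has_field_derivative w * eta w ^ 2 * (2 * eta_logderiv w + 1 / w)) (at w)"
      by (rule DERIV_cong) (use w0 in \<open>simp add: field_simps power2_eq_square\<close>)
    show "w * eta w ^ 2 \<noteq> 0"
      using w0 eta_nonzero[OF w] by simp
  qed
  then obtain c where c: "\<And>w. w \<in> Hplane \<Longrightarrow> K w = c"
    using has_field_derivative_zero_constant[OF convex_Hplane] by (metis has_field_derivative_at_within)
  have "\<i> \<in> Hplane" "- 1 / \<i> = \<i>"
    by (simp_all add: in_Hplane_iff field_simps)
  hence "K z = - \<i>"
    using c[of \<i>] c[OF z] eta_nonzero[of \<i>] by (simp add: K_def divide_simps)
  thus ?thesis
    using z eta_nonzero[OF z] Hplane_nonzero[OF z] by (simp add: K_def divide_eq_eq)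
qed

section \<open>Expansions in fractional powers of \<open>q\<close>\<close>

lemma qpow_exponent_add: "qpow t (m + n) z = qpow t m z * qpow t n z"
  by (simp add: qpow_def ring_distribs add_divide_distrib flip: exp_add)

lemma qpow_arg_add: "qpow t n (z + w) = qpow t n z * qpow t n w"
  by (simp add: qpow_def ring_distribs add_divide_distrib exp_add)

lemma qpow_eq_power: "qpow t (int k) z = qpow t 1 z ^ k"
  unfolding qpow_def exp_of_nat_mult[symmetric] by (simp add: algebra_simps)

lemma qpow_divide: "qpow t n (z / of_nat N) = qpow (t * N) n z"
  by (simp add: qpow_def mult.commute)

lemma norm_qpow: "norm (qpow t n z) = exp (- 2 * pi * of_int n * Im z / of_nat t)"
  unfolding qpow_def norm_exp_eq_Re by (simp add: Re_divide_of_nat)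

abbreviation Im_at_top :: "complex filter" where
  "Im_at_top \<equiv> filtercomap Im at_top"

lemma qpow_tendsto_0:
  assumes "t > 0"
  shows "(qpow t 1 \<longlongrightarrow> 0) Im_at_top"
proof (rule tendsto_norm_zero_cancel)
  define c where "c = 2 * pi / real t"
  have "c > 0"
    using assms by (simp add: c_def)
  hence "((\<lambda>y. exp (- c * y)) \<longlongrightarrow> 0) at_top"
    by real_asymp
  hence "((\<lambda>z. exp (- c * Im z)) \<longlongrightarrow> 0) Im_at_top"
    by (rule filterlim_compose) (rule filterlim_filtercomap)
  thus "((\<lambda>z. norm (qpow t 1 z)) \<longlongrightarrow> 0) Im_at_top"
    by (simp add: norm_qpow c_def)
qed

definition q_expansion :: "nat \<Rightarrow> (int \<Rightarrow> complex) \<Rightarrow> (complex \<Rightarrow> complex) \<Rightarrow> bool" where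
  "q_expansion t a f \<longleftrightarrow> (\<exists>N. \<forall>n<N. a n = 0) \<and>
     (\<forall>z\<in>Hplane. ((\<lambda>n. a n * qpow t n z) has_sum f z) UNIV)"

lemma q_expansion_has_sum:
  "q_expansion t a f \<Longrightarrow> z \<in> Hplane \<Longrightarrow> ((\<lambda>n. a n * qpow t n z) has_sum f z) UNIV"
  by (simp add: q_expansion_def)

lemma q_expansion_bound:
  assumes "q_expansion t a f"
  obtains N where "N \<le> 0" "\<And>n. n < N \<Longrightarrow> a n = 0"
proof -
  obtain N where "\<And>n. n < N \<Longrightarrow> a n = 0"
    using assms by (auto simp: q_expansion_def)
  thus thesis
    using that[of "min N 0"] by simp
qed

lemma mero_at_infty_iff: "mero_at_infty f \<longleftrightarrow> (\<exists>t>0. \<exists>a. q_expansion t a f)"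
  by (auto simp: mero_at_infty_def q_expansion_def)

lemma q_expansion_cong:
  "(\<And>z. z \<in> Hplane \<Longrightarrow> f z = g z) \<Longrightarrow> q_expansion t a f \<longleftrightarrow> q_expansion t a g"
  by (simp add: q_expansion_def)

lemma q_expansion_zero: "q_expansion t (\<lambda>_. 0) (\<lambda>_. 0)"
  by (simp add: q_expansion_def)

lemma q_expansion_cmult: "q_expansion t a f \<Longrightarrow> q_expansion t (\<lambda>n. c * a n) (\<lambda>z. c * f z)"
  unfolding q_expansion_def by (auto intro!: has_sum_cmult_right simp: mult.assoc)

lemma q_expansion_add:
  assumes f: "q_expansion t a f" and g: "q_expansion t b g"
  shows "q_expansion t (\<lambda>n. a n + b n) (\<lambda>z. f z + g z)"
proof -
  obtain M N where "\<And>n. n < M \<Longrightarrow> a n = 0" "\<And>n. n < N \<Longrightarrow> b n = 0"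
    using q_expansion_bound[OF f] q_expansion_bound[OF g] by metis
  hence "\<forall>n<min M N. a n + b n = 0"
    by simp
  hence "\<exists>N. \<forall>n<N. a n + b n = 0"
    by blast
  thus ?thesis
    using has_sum_add[OF q_expansion_has_sum[OF f] q_expansion_has_sum[OF g]]
    unfolding q_expansion_def by (auto simp: distrib_right)
qed

lemma q_expansion_translate_divide:
  fixes x :: real
  assumes "q_expansion t a f" "N > 0"
  shows "q_expansion (t * N) (\<lambda>n. a n * qpow (t * N) n (of_real x)) (\<lambda>z. f ((z + of_real x) / of_nat N))"
proof -
  have "((\<lambda>n. a n * qpow (t * N) n (of_real x) * qpow (t * N) n z) has_sum f ((z + of_real x) / of_nat N)) UNIV"
    if "z \<in> Hplane" for z
  proof -
    have "(z + of_real x) / of_nat N \<in> Hplane"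
      using that assms(2) by (simp add: in_Hplane_iff Im_divide_of_nat)
    from q_expansion_has_sum[OF assms(1) this] show ?thesis
      by (simp only: qpow_divide qpow_arg_add mult_ac)
  qed
  thus ?thesis
    using assms(1) by (auto simp: q_expansion_def)
qed

lemma q_expansion_sums_power_series:
  assumes f: "q_expansion t a f" and m: "\<And>n. n < m \<Longrightarrow> a n = 0" and z: "z \<in> Hplane"
  shows "(\<lambda>k. a (m + int k) * qpow t 1 z ^ k) sums (f z * qpow t (- m) z)"
proof -
  have "((\<lambda>n. a n * qpow t n z * qpow t (- m) z) has_sum (f z * qpow t (- m) z)) UNIV"
    by (intro has_sum_cmult_left q_expansion_has_sum[OF f z])
  also have "?this \<longleftrightarrow>
      ((\<lambda>n. a n * qpow t n z * qpow t (- m) z) has_sum (f z * qpow t (- m) z)) (range (\<lambda>k. m + int k))"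
  proof (rule has_sum_cong_neutral)
    fix n assume "n \<in> UNIV - range (\<lambda>k. m + int k)"
    hence "n < m"
      using rangeI[of "\<lambda>k. m + int k" "nat (n - m)"] by auto
    thus "a n * qpow t n z * qpow t (- m) z = 0"
      by (simp add: m)
  qed auto
  also have "\<dots> \<longleftrightarrow> ((\<lambda>k. a (m + int k) * qpow t 1 z ^ k) has_sum (f z * qpow t (- m) z)) UNIV"
  proof (subst has_sum_reindex)
    have "qpow t (m + int k) z * qpow t (- m) z = qpow t 1 z ^ k" for k
      using qpow_exponent_add[of t "m + int k" "- m" z] by (simp add: qpow_eq_power)
    thus "((\<lambda>n. a n * qpow t n z * qpow t (- m) z) \<circ> (\<lambda>k. m + int k) has_sum (f z * qpow t (- m) z)) UNIV \<longleftrightarrow>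
        ((\<lambda>k. a (m + int k) * qpow t 1 z ^ k) has_sum (f z * qpow t (- m) z)) UNIV"
      by (simp add: o_def mult.assoc)
  qed (simp add: inj_def)
  finally show ?thesis
    by (rule has_sum_imp_sums)
qed

lemma q_expansion_leading_coeff:
  assumes f: "q_expansion t a f" and t: "t > 0" and m: "\<And>n. n < m \<Longrightarrow> a n = 0"
  shows "((\<lambda>z. f z * qpow t (- m) z) \<longlongrightarrow> a m) Im_at_top"
proof -
  define c where "c = (\<lambda>k. a (m + int k))"
  have sums: "(\<lambda>k. c k * qpow t 1 z ^ k) sums (f z * qpow t (- m) z)" if "z \<in> Hplane" for z
    unfolding c_def by (rule q_expansion_sums_power_series[OF f m that])
  have "isCont (\<lambda>x. \<Sum>k. c k * x ^ k) 0"
  proof (rule isCont_powser)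
    show "summable (\<lambda>k. c k * qpow t 1 \<i> ^ k)"
      using sums[of \<i>] by (simp add: sums_iff in_Hplane_iff)
  qed (simp add: norm_qpow)
  from isCont_tendsto_compose[OF this qpow_tendsto_0[OF t]]
  have "((\<lambda>z. \<Sum>k. c k * qpow t 1 z ^ k) \<longlongrightarrow> a m) Im_at_top"
    by (simp add: c_def)
  moreover have "eventually (\<lambda>z. (\<Sum>k. c k * qpow t 1 z ^ k) = f z * qpow t (- m) z) Im_at_top"
    unfolding eventually_filtercomap_at_top_linorder
    using sums by (intro exI[of _ 1]) (auto simp: sums_iff in_Hplane_iff)
  ultimately show ?thesis
    by (rule Lim_transform_eventually)
qed

lemma holomorphic_imp_has_sum_power_series:
  assumes "R holomorphic_on ball 0 1" "norm x < 1"
  shows "((\<lambda>k. (deriv ^^ k) R 0 / fact k * x ^ k) has_sum R x) UNIV"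
proof -
  define c where "c = (\<lambda>k. (deriv ^^ k) R 0 / fact k)"
  have sums: "(\<lambda>k. c k * y ^ k) sums R y" if "norm y < 1" for y
    using holomorphic_power_series[OF assms(1), of y] that by (simp add: c_def)
  obtain r where r: "norm x < r" "r < 1"
    using assms(2) dense by blast
  hence "norm (complex_of_real r) = r"
    using norm_ge_zero[of x] by (simp del: norm_ge_zero)
  hence "summable (\<lambda>k. norm (c k * x ^ k))"
    using r by (intro powser_insidea[OF sums_summable[OF sums[of "of_real r"]]]) auto
  from norm_summable_imp_has_sum[OF this sums[OF assms(2)]] show ?thesis
    by (simp add: c_def)
qed

lemma q_expansion_of_holomorphic:
  assumes t: "t > 0" and R: "R holomorphic_on ball 0 1"
    and f: "\<And>z. z \<in> Hplane \<Longrightarrow> f z = qpow t m z * R (nome z)"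
  obtains a where "q_expansion t a f" "\<And>n. n < m \<Longrightarrow> a n = 0" "a m = R 0"
    "\<And>n. a n \<noteq> 0 \<Longrightarrow> n mod int t = m mod int t"
proof -
  define c where "c = (\<lambda>k. (deriv ^^ k) R 0 / fact k)"
  define i where "i = (\<lambda>k::nat. m + int t * int k)"
  define a where "a = (\<lambda>n. if n \<in> range i then c (nat ((n - m) div int t)) else 0)"
  have a_i: "a (i k) = c k" for k
    using t by (simp add: a_def i_def)
  have inj: "inj i"
    using t by (auto simp: i_def inj_def)
  have "((\<lambda>n. a n * qpow t n z) has_sum f z) UNIV" if z: "z \<in> Hplane" for z
  proof -
    have "((\<lambda>k. qpow t m z * (c k * nome z ^ k)) has_sum f z) UNIV"
      unfolding c_def f[OF z]
      by (intro has_sum_cmult_right holomorphic_imp_has_sum_power_series[OF R] norm_nome_less_one z)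
    also have "(\<lambda>k. qpow t m z * (c k * nome z ^ k)) = (\<lambda>n. a n * qpow t n z) \<circ> i"
    proof
      fix k
      have "nome z ^ k = qpow t (int t * int k) z"
        using t unfolding qpow_def exp_of_nat_mult[symmetric] by (simp add: algebra_simps)
      thus "qpow t m z * (c k * nome z ^ k) = ((\<lambda>n. a n * qpow t n z) \<circ> i) k"
        using a_i[of k] by (simp add: i_def qpow_exponent_add)
    qed
    finally have "((\<lambda>n. a n * qpow t n z) has_sum f z) (range i)"
      unfolding has_sum_reindex[OF inj] .
    thus ?thesis
      by (rule has_sum_cong_neutral[THEN iffD1, rotated -1]) (auto simp: a_def)
  qed
  moreover have "a n = 0" if "n < m" for n
    using that by (auto simp: a_def i_def simp flip: of_nat_mult)
  moreover have "n mod int t = m mod int t" if "a n \<noteq> 0" for n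
    using that by (auto simp: a_def i_def split: if_splits)
  moreover have "a m = R 0"
    using a_i[of 0] by (simp add: i_def c_def)
  ultimately show thesis
    using that[of a] by (auto simp: q_expansion_def)
qed

section \<open>Transformation laws under \<open>\<Gamma>\<^sub>0(2)\<close>\<close>

definition slash_eigenform :: "int \<Rightarrow> mat2 \<Rightarrow> complex \<Rightarrow> (complex \<Rightarrow> complex) \<Rightarrow> bool" where
  "slash_eigenform k M c f \<longleftrightarrow> (\<forall>z\<in>Hplane. slash k M f z = c * f z)"

lemma slash_eigenform_slash:
  assumes "slash_eigenform k M c f" "det2 M > 0" "det2 N > 0" "z \<in> Hplane"
  shows "slash k (M \<odot> N) f z = c * slash k N f z"
proof -
  have "slash k (M \<odot> N) f z = slash k N (slash k M f) z"
    using slash_slash[OF assms(2-4)] by simp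
  also have "\<dots> = slash k N (\<lambda>z. c * f z) z"
    using assms(1) by (intro slash_cong[OF _ assms(3,4)]) (auto simp: slash_eigenform_def)
  finally show ?thesis
    by (simp add: slash_cmult)
qed

lemma slash_eigenform_mult:
  assumes "slash_eigenform k M c f" "slash_eigenform k N c' f" "det2 M > 0" "det2 N > 0"
  shows "slash_eigenform k (M \<odot> N) (c * c') f"
  using slash_eigenform_slash[OF assms(1,3,4)] assms(2) by (simp add: slash_eigenform_def)

lemma imaginary_unit_powi_cong:
  assumes "m mod 4 = (n :: int) mod 4"
  shows "\<i> powi m = \<i> powi n"
proof -
  obtain j where "m = n + 4 * j"
    using assms by (metis mod_eqE)
  moreover have "\<i> powi (4 * j) = (\<i> powi 4) powi j" "\<i> powi 4 = 1"
    by (simp_all only: power_int_mult) (simp add: power_int_def)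
  ultimately show ?thesis
    by (simp add: power_int_add)
qed

lemma det_one_even_imp_odd:
  fixes a b c d :: int
  assumes "a * d - b * c = 1" "even c"
  shows "odd a" "odd d"
proof -
  have "a * d = 1 + b * c"
    using assms by simp
  hence "odd (a * d)"
    using assms(2) by simp
  thus "odd a" "odd d"
    by simp_all
qed

lemma odd_square_mod_4: "odd (x :: int) \<Longrightarrow> 4 dvd x * x - 1"
  by (elim oddE) (simp add: algebra_simps)

lemma nu0_mult:
  assumes "a * d - b * c = 1" "even c" "a' * d' - b' * c' = 1" "even c'"
  shows "nu0 (a * a' + b * c') (a * b' + b * d') (c * a' + d * c') (c * b' + d * d') = nu0 a b c d * nu0 a' b' c' d'"
proof -
  obtain g g' where g: "c = 2 * g" "c' = 2 * g'"
    using assms by (auto elim!: evenE)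
  have odd: "odd a" "odd d" "odd a'" "odd d'"
    using det_one_even_imp_odd assms by blast+
  have det: "a * d = 1 + 2 * g * b" "a' * d' = 1 + 2 * g' * b'"
    using assms unfolding g by (auto simp: algebra_simps)
  have "(2 * g * b' + d * d') * ((a * b' + b * d') - (g * a' + d * g')) - (d * (b - g) + d' * (b' - g')) =
      d' * b' * (a * d) - g * d * (a' * d') + b * d * (d' * d') - (d * d) * d' * g'
        + 2 * g * b' * (a * b' + b * d' - g * a' - d * g') - (d * (b - g) + d' * (b' - g'))"
    by (simp add: algebra_simps)
  also have "\<dots> = b * d * (d' * d' - 1) - (d * d - 1) * (d' * g') + 4 * (g * b' * (b * d' - d * g'))
      + 2 * (g * b' * (a * b' - g * a'))"
    unfolding det by (simp add: algebra_simps)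
  also have "4 dvd \<dots>"
  proof (intro dvd_add dvd_diff)
    have "even (g * b' * (a * b' - g * a'))"
      using odd by auto
    thus "4 dvd 2 * (g * b' * (a * b' - g * a'))"
      using mult_dvd_mono[of 2 2 2 "g * b' * (a * b' - g * a')"] by simp
  qed (use odd_square_mod_4 odd in \<open>auto intro: dvd_mult dvd_mult2\<close>)
  finally have "((c * b' + d * d') * ((a * b' + b * d') - (g * a' + d * g'))) mod 4 =
      (d * (b - g) + d' * (b' - g')) mod 4"
    by (simp only: mod_eq_dvd_iff g)
  from imaginary_unit_powi_cong[OF this]
  have "\<i> powi ((c * b' + d * d') * ((a * b' + b * d') - (g * a' + d * g'))) =
      \<i> powi (d * (b - g)) * \<i> powi (d' * (b' - g'))"
    by (simp only: power_int_add[OF disjI1[OF complex_i_not_zero]])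
  moreover have "(c * a' + d * c') div 2 = g * a' + d * g'" "c div 2 = g" "c' div 2 = g'"
    unfolding g by (simp_all add: algebra_simps flip: distrib_left)
  ultimately show ?thesis
    by (simp only: nu0_def)
qed

lemma exists_reduced_residue:
  fixes x y :: int
  assumes "y \<noteq> 0" "odd x \<noteq> odd y"
  shows "\<exists>n. \<bar>x + 2 * n * y\<bar> < \<bar>y\<bar>"
proof -
  define q r where "q = (x + y) div (2 * y)" and "r = (x + y) mod (2 * y)"
  have eq: "x + y = 2 * y * q + r"
    unfolding q_def r_def by (rule mult_div_mod_eq[symmetric])
  have "odd (x + y)"
    using assms(2) by simp
  hence "odd r"
    unfolding eq by simp
  hence "r \<noteq> 0"
    by auto
  hence "\<bar>r - y\<bar> < \<bar>y\<bar>"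
    using assms(1) pos_mod_bound[of "2 * y" "x + y"] neg_mod_bound[of "2 * y" "x + y"]
      pos_mod_sign[of "2 * y" "x + y"] neg_mod_sign[of "2 * y" "x + y"]
    unfolding r_def by linarith
  moreover have "x + 2 * (- q) * y = r - y"
    using eq by (simp add: algebra_simps)
  ultimately show ?thesis
    by metis
qed

locale Fricke_eigenform =
  fixes k e :: int and s :: complex and f :: "complex \<Rightarrow> complex"
  assumes even_weight: "even k"
    and sign: "s\<^sup>2 = 1"
    and translation: "slash_eigenform k (imat 1 1 0 1) (\<i> powi e) f"
    and Fricke: "slash_eigenform k (imat 0 (-1) 2 0) s f"
begin

definition Gamma0_law :: "int \<Rightarrow> int \<Rightarrow> int \<Rightarrow> int \<Rightarrow> bool" where
  "Gamma0_law a b c d \<longleftrightarrow> slash_eigenform k (imat a b c d) (nu0 a b c d powi e) f"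

lemma Gamma0_law_mult:
  assumes "Gamma0_law a b c d" "Gamma0_law a' b' c' d'"
    and "a * d - b * c = 1" "even c" "a' * d' - b' * c' = 1" "even c'"
  shows "Gamma0_law (a * a' + b * c') (a * b' + b * d') (c * a' + d * c') (c * b' + d * d')"
  using slash_eigenform_mult[OF assms(1,2)[unfolded Gamma0_law_def]] assms(3-)
  by (simp add: Gamma0_law_def nu0_mult det2_imat imat_mult power_int_mult_distrib)

lemma Gamma0_law_uminus:
  assumes "Gamma0_law a b c d" "a * d - b * c = 1" "even c"
  shows "Gamma0_law (- a) (- b) (- c) (- d)"
proof -
  have "slash k (imat (- a) (- b) (- c) (- d)) f z = slash k (imat a b c d) f z" for z
    using slash_scale[OF even_weight, of "- 1" "of_int a" "of_int b" "of_int c" "of_int d" f z] assms(2)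
    by (simp add: det2_imat)
  moreover have "(- c) div 2 = - (c div 2)"
    using assms(3) by (rule dvd_neg_div)
  hence "nu0 (- a) (- b) (- c) (- d) = nu0 a b c d"
    by (simp add: nu0_def algebra_simps)
  ultimately show ?thesis
    using assms(1) by (simp add: Gamma0_law_def slash_eigenform_def)
qed

lemma Gamma0_law_translation: "Gamma0_law 1 n 0 1"
proof -
  have "f (z + 1) = \<i> powi e * f z" if "z \<in> Hplane" for z
    using translation slash_translation[of k 1 f z] that by (simp add: slash_eigenform_def)
  hence "f (z + of_int n) = nu0 1 n 0 1 powi e * f z" if "z \<in> Hplane" for z
    using shift_int_multiplier[of f "\<i> powi e" z n] that
    by (simp add: nu0_def mult.commute[of e n] flip: power_int_mult)
  thus ?thesis
    using slash_translation[of k "of_int n"] by (simp add: Gamma0_law_def slash_eigenform_def)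
qed

text \<open>\<open>(1, 0; 2m, 1) = - (1/2) W\<^sub>2 (1, -m; 0, 1) W\<^sub>2\<close>.\<close>

lemma Gamma0_law_lower_triangular: "Gamma0_law 1 0 (2 * m) 1"
proof -
  have "slash_eigenform k (imat 0 (-1) 2 0 \<odot> imat 1 (- m) 0 1 \<odot> imat 0 (-1) 2 0)
      (s * nu0 1 (- m) 0 1 powi e * s) f"
    using Gamma0_law_translation[of "- m"] Fricke unfolding Gamma0_law_def
    by (intro slash_eigenform_mult) (simp_all only: det2_mult det2_imat, simp_all)
  also have "imat 0 (-1) 2 0 \<odot> imat 1 (- m) 0 1 \<odot> imat 0 (-1) 2 0 =
      (- 2 * 1, - 2 * 0, - 2 * of_int (2 * m), - 2 * 1)"
    by (simp add: mat2_mult_def)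
  also have "s * nu0 1 (- m) 0 1 powi e * s = nu0 1 0 (2 * m) 1 powi e"
    using sign by (simp add: nu0_def power2_eq_square mult_ac)
  finally show ?thesis
    using slash_scale[OF even_weight, of "- 2" 1 0 "of_int (2 * m)" 1]
    by (simp add: Gamma0_law_def slash_eigenform_def det2_def)
qed

lemma Gamma0_law_descent:
  assumes det: "a * d - b * c = 1" "even c" and "c \<noteq> 0"
  obtains a' b' c' d' where "a' * d' - b' * c' = 1" "even c'" "\<bar>c'\<bar> < \<bar>c\<bar>"
    "Gamma0_law a' b' c' d' \<Longrightarrow> Gamma0_law a b c d"
proof -
  have "odd d"
    using det_one_even_imp_odd(2)[OF det] .
  then obtain n where n: "\<bar>d + 2 * n * c\<bar> < \<bar>c\<bar>"
    using exists_reduced_residue[of c d] assms(2,3) by auto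
  define b' d' where "b' = b + 2 * n * a" and "d' = d + 2 * n * c"
  have "odd d'"
    using \<open>odd d\<close> by (simp add: d'_def)
  then obtain m where m: "\<bar>c + 2 * m * d'\<bar> < \<bar>d'\<bar>"
    using exists_reduced_residue[of d' c] det(2) by fastforce
  define a' c' where "a' = a + 2 * m * b'" and "c' = c + 2 * m * d'"
  have det': "a' * d' - b' * c' = 1" "even c'" "a * d' - b' * c = 1"
    using det by (simp_all add: a'_def d'_def b'_def c'_def algebra_simps)
  have "\<bar>c'\<bar> < \<bar>c\<bar>"
    using m n by (simp add: c'_def d'_def)
  moreover have "Gamma0_law a b c d" if "Gamma0_law a' b' c' d'"
  proof -
    from Gamma0_law_mult[OF that Gamma0_law_lower_triangular[of "- m"] det'(1,2)]
    have "Gamma0_law a b' c d'"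
      by (simp add: a'_def c'_def)
    from Gamma0_law_mult[OF this Gamma0_law_translation[of "- 2 * n"] det'(3) det(2)]
    show ?thesis
      by (simp add: b'_def d'_def)
  qed
  ultimately show thesis
    using that det'(1,2) by blast
qed

lemma Gamma0_law_all:
  assumes "a * d - b * c = 1" "even c"
  shows "Gamma0_law a b c d"
  using assms
proof (induction "nat \<bar>c\<bar>" arbitrary: a b c d rule: less_induct)
  case less
  show ?case
  proof (cases "c = 0")
    case True
    hence "a = 1 \<and> d = 1 \<or> a = -1 \<and> d = -1"
      using less.prems by (simp add: zmult_eq_1_iff)
    thus ?thesis
      using True Gamma0_law_translation[of b] Gamma0_law_uminus[OF Gamma0_law_translation[of "- b"]] by auto
  next
    case False
    obtain a' b' c' d' where "a' * d' - b' * c' = 1" "even c'" "\<bar>c'\<bar> < \<bar>c\<bar>"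
      "Gamma0_law a' b' c' d' \<Longrightarrow> Gamma0_law a b c d"
      by (rule Gamma0_law_descent[OF less.prems False]) blast
    moreover from this have "nat \<bar>c'\<bar> < nat \<bar>c\<bar>"
      by simp
    ultimately show ?thesis
      using less.hyps by blast
  qed
qed

end

section \<open>Forms for the Fricke group\<close>

text \<open>
  The support condition on the coefficients encodes \<open>f(z + 1) = i\<^sup>e f(z)\<close>; together with the law
  under \<open>W\<^sub>2\<close> it determines the behaviour under the whole group.
\<close>

definition Fricke_form :: "int \<Rightarrow> int \<Rightarrow> complex \<Rightarrow> (int \<Rightarrow> complex) \<Rightarrow> (complex \<Rightarrow> complex) \<Rightarrow> bool" where
  "Fricke_form k e s a f \<longleftrightarrow> f holomorphic_on Hplane \<and> slash_eigenform k (imat 0 (-1) 2 0) s f \<and>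
     q_expansion 4 a f \<and> (\<forall>n. a n \<noteq> 0 \<longrightarrow> n mod 4 = e mod 4)"

lemma Fricke_formD:
  assumes "Fricke_form k e s a f"
  shows "f holomorphic_on Hplane" "slash_eigenform k (imat 0 (-1) 2 0) s f" "q_expansion 4 a f"
    "a n \<noteq> 0 \<Longrightarrow> n mod 4 = e mod 4"
  using assms by (auto simp: Fricke_form_def)

lemma Fricke_form_exponent_cong:
  "e mod 4 = e' mod 4 \<Longrightarrow> Fricke_form k e s a f \<longleftrightarrow> Fricke_form k e' s a f"
  by (simp add: Fricke_form_def)

lemma Fricke_form_zero: "Fricke_form k e s (\<lambda>_. 0) (\<lambda>_. 0)"
  using slash_cmult[of k _ 0 "\<lambda>_. 0"] by (simp add: Fricke_form_def slash_eigenform_def q_expansion_zero)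

lemma Fricke_form_cmult:
  "Fricke_form k e s a f \<Longrightarrow> Fricke_form k e s (\<lambda>n. c * a n) (\<lambda>z. c * f z)"
  unfolding Fricke_form_def
  by (auto intro!: holomorphic_intros q_expansion_cmult simp: slash_eigenform_def slash_cmult)

lemma Fricke_form_add:
  assumes "Fricke_form k e s a f" "Fricke_form k e s b g"
  shows "Fricke_form k e s (\<lambda>n. a n + b n) (\<lambda>z. f z + g z)"
proof -
  have "n mod 4 = e mod 4" if "a n + b n \<noteq> 0" for n
    using that assms unfolding Fricke_form_def by (metis add.right_neutral)
  thus ?thesis
    using assms unfolding Fricke_form_def
    by (auto intro!: holomorphic_intros q_expansion_add simp: slash_eigenform_def slash_add distrib_left)
qed

lemma Fricke_form_diff_cmult:
  assumes "Fricke_form k e s a f" "Fricke_form k e s b g"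
  shows "Fricke_form k e s (\<lambda>n. a n - c * b n) (\<lambda>z. f z - c * g z)"
  using Fricke_form_add[OF assms(1) Fricke_form_cmult[OF assms(2), of "- c"]] by simp

lemma qpow_4_one: "qpow 4 n 1 = \<i> powi n"
proof -
  have "exp (of_int n * (\<i> * of_real pi / 2)) = exp (\<i> * of_real pi / 2) powi n"
    by (simp add: exp_power_int)
  also have "exp (\<i> * of_real pi / 2) = \<i>"
    using cis_conv_exp[of "pi / 2"] by (simp add: cis_pi_half)
  finally show ?thesis
    by (simp add: qpow_def algebra_simps)
qed

lemma Fricke_form_translation:
  assumes f: "Fricke_form k e s a f" and z: "z \<in> Hplane"
  shows "f (z + 1) = \<i> powi e * f z"
proof (rule has_sum_unique)
  have "z + 1 \<in> Hplane"
    using z by (simp add: in_Hplane_iff)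
  thus "((\<lambda>n. a n * qpow 4 n (z + 1)) has_sum f (z + 1)) UNIV"
    using q_expansion_has_sum Fricke_formD(3)[OF f] by blast
  have "a n * qpow 4 n (z + 1) = \<i> powi e * (a n * qpow 4 n z)" for n
    using Fricke_formD(4)[OF f, of n] imaginary_unit_powi_cong[of n e]
    by (cases "a n = 0") (auto simp: qpow_arg_add qpow_4_one)
  thus "((\<lambda>n. a n * qpow 4 n (z + 1)) has_sum (\<i> powi e * f z)) UNIV"
    using has_sum_cmult_right[OF q_expansion_has_sum[OF Fricke_formD(3)[OF f] z], of "\<i> powi e"]
    by (simp only:)
qed

lemma Fricke_form_Gamma0:
  assumes "Fricke_form k e s a f" "even k" "s\<^sup>2 = 1" "p * u - q * r = 1" "even r"
  shows "slash_eigenform k (imat p q r u) (nu0 p q r u powi e) f"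
proof -
  interpret Fricke_eigenform k e s f
  proof
    show "slash_eigenform k (imat 1 1 0 1) (\<i> powi e) f"
      using Fricke_form_translation[OF assms(1)] slash_translation[of k 1] by (simp add: slash_eigenform_def)
  qed (use assms Fricke_formD in auto)
  show ?thesis
    using Gamma0_law_all[OF assms(4,5)] by (simp add: Gamma0_law_def)
qed

lemma slash_translate_divide:
  assumes "p > 0"
  shows "slash k (1, x, 0, p) f z = of_real (p powr (- of_int k / 2)) * f ((z + of_real x) / of_real p)"
proof -
  have "p powi (- k) = p powr (- of_int k)"
    using assms powr_real_of_int'[of p "- k"] by simp
  hence "p powr (of_int k / 2) * p powi (- k) = p powr (of_int k / 2 + - of_int k)"
    by (simp only: powr_add)
  hence "(of_real (p powr (of_int k / 2) * p powi (- k)) :: complex) = of_real (p powr (- of_int k / 2))"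
    by (simp add: field_simps)
  thus ?thesis
    by (simp add: slash_def)
qed

lemma Fricke_form_slash_odd:
  assumes f: "Fricke_form k e s a f" and k: "even k" and s: "s\<^sup>2 = 1"
    and det: "p * u - q * r = 1" and r: "odd r"
  obtains c and j :: int where "\<And>z. z \<in> Hplane \<Longrightarrow> slash k (imat p q r u) f z = c * f ((z + of_int j) / 2)"
proof -
  \<comment> \<open>\<open>2 (p, q; r, u) = (-q', p; -u', r) W\<^sub>2 (1, j; 0, 2)\<close>\<close>
  define j q' u' where "j = u mod 2" and "q' = q - j * p" and "u' = u - j * r"
  define c where "c = nu0 (- q') p (- u') r powi e * s"
  define M where "M = imat (- q') p (- u') r \<odot> imat 0 (-1) 2 0"
  have "even (- u')"
    using r unfolding u'_def j_def by (cases "even u") auto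
  moreover have det': "(- q') * r - p * (- u') = 1"
    using det by (simp add: q'_def u'_def algebra_simps)
  ultimately have c: "slash_eigenform k M c f"
    unfolding c_def M_def using det2_imat[of "- q'" p "- u'" r]
    by (intro slash_eigenform_mult Fricke_form_Gamma0[OF f k s] Fricke_formD(2)[OF f]) (simp_all add: det2_tuple)
  have det_M: "det2 M > 0"
    unfolding M_def det2_mult det2_imat det' by simp
  have M: "M \<odot> (1, of_int j, 0, 2) = (2 * of_int p, 2 * of_int q, 2 * of_int r, 2 * of_int u)"
    by (simp add: M_def mat2_mult_def q'_def u'_def algebra_simps)
  have "slash k (imat p q r u) f z = c * of_real (2 powr (- of_int k / 2)) * f ((z + of_int j) / 2)"
    if z: "z \<in> Hplane" for z
  proof -
    have "slash k (imat p q r u) f z = slash k (2 * of_int p, 2 * of_int q, 2 * of_int r, 2 * of_int u) f z"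
      by (rule slash_scale[OF k, symmetric]) (use det det2_imat[of p q r u] in simp_all)
    also have "\<dots> = c * slash k (1, of_int j, 0, 2) f z"
      unfolding M[symmetric] by (rule slash_eigenform_slash[OF c det_M _ z]) (simp add: det2_tuple)
    finally show ?thesis
      using slash_translate_divide[of 2 k "of_int j" f z] by simp
  qed
  thus thesis
    by (rule that)
qed

lemma Fricke_form_mero_at_cusps:
  assumes f: "Fricke_form k e s a f" and k: "even k" and s: "s\<^sup>2 = 1"
  shows "mero_at_cusps k f"
  unfolding mero_at_cusps_def
proof (intro allI impI)
  fix p q r u :: int
  assume det: "p * u - q * r = 1"
  show "mero_at_infty (slash k (imat p q r u) f)"
  proof (cases "even r")
    case True
    from q_expansion_cmult[OF Fricke_formD(3)[OF f]] Fricke_form_Gamma0[OF f k s det True]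
    have "q_expansion 4 (\<lambda>n. nu0 p q r u powi e * a n) (slash k (imat p q r u) f)"
      by (subst q_expansion_cong) (auto simp: slash_eigenform_def)
    thus ?thesis
      unfolding mero_at_infty_iff by (intro exI[of _ 4]) auto
  next
    case False
    then obtain c j where slash: "\<And>z. z \<in> Hplane \<Longrightarrow> slash k (imat p q r u) f z = c * f ((z + of_int j) / 2)"
      using Fricke_form_slash_odd[OF f k s det] by blast
    have "q_expansion (4 * 2) (\<lambda>n. c * (a n * qpow (4 * 2) n (of_real (of_int j)))) (slash k (imat p q r u) f)"
      using q_expansion_cmult[OF q_expansion_translate_divide[OF Fricke_formD(3)[OF f]], of 2 c "of_int j"]
      by (subst q_expansion_cong[OF slash]) simp_all
    thus ?thesis
      unfolding mero_at_infty_iff by (intro exI[of _ "4 * 2"]) auto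
  qed
qed

lemma nu0_powi:
  assumes "e mod 4 = 1"
  shows "nu0 a b c d powi e = nu0 a b c d" "nu0 a b c d powi (- e) = nu0_conj a b c d"
proof -
  define m where "m = d * (b - c div 2)"
  have "m * e mod 4 = m mod 4"
    using assms by (metis mod_mult_right_eq mult_1_right)
  from imaginary_unit_powi_cong[OF this] show pos: "nu0 a b c d powi e = nu0 a b c d"
    by (simp only: nu0_def m_def power_int_mult)
  have "cnj (nu0 a b c d) = inverse \<i> powi m"
    by (simp add: nu0_def m_def power_int_def)
  also have "\<dots> = inverse (nu0 a b c d)"
    by (simp only: nu0_def m_def power_int_inverse)
  finally show "nu0 a b c d powi (- e) = nu0_conj a b c d"
    by (simp only: power_int_minus pos nu0_conj_def)
qed

lemma wh_form_iff_Fricke_form: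
  assumes "even k" "s\<^sup>2 = 1" "q_expansion 4 a f" "\<And>n. a n \<noteq> 0 \<Longrightarrow> n mod 4 = e mod 4"
  shows "wh_form k (\<lambda>p q r u. nu0 p q r u powi e) s f \<longleftrightarrow> Fricke_form k e s a f"
proof
  assume "wh_form k (\<lambda>p q r u. nu0 p q r u powi e) s f"
  thus "Fricke_form k e s a f"
    using assms by (simp add: wh_form_def Fricke_form_def slash_eigenform_def)
next
  assume f: "Fricke_form k e s a f"
  show "wh_form k (\<lambda>p q r u. nu0 p q r u powi e) s f"
    using Fricke_formD(1,2)[OF f] Fricke_form_Gamma0[OF f assms(1,2)] Fricke_form_mero_at_cusps[OF f assms(1,2)]
    by (simp add: wh_form_def slash_eigenform_def)
qed

section \<open>Functions invariant under the Fricke group\<close>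

lemma Hplane_double: "z \<in> Hplane \<Longrightarrow> 2 * z \<in> Hplane"
  by (simp add: in_Hplane_iff)

lemma Hplane_Fricke: "z \<in> Hplane \<Longrightarrow> - 1 / (2 * z) \<in> Hplane"
  by (rule Hplane_neg_inverse[OF Hplane_double])

text \<open>
  Aiming only at height \<open>1/4\<close> instead of the optimal \<open>1/2\<close> makes termination of the reduction to a
  fundamental domain immediate.
\<close>

lemma Im_Fricke_ge:
  assumes "z \<in> Hplane" "\<bar>Re z\<bar> \<le> 1/2" "Im z \<le> 1/4"
  shows "Im (- 1 / (2 * z)) \<ge> 8/5 * Im z"
proof -
  have pos: "Im z > 0"
    using assms(1) by (simp add: in_Hplane_iff)
  have "(Re z)\<^sup>2 \<le> (1/2)\<^sup>2" "(Im z)\<^sup>2 \<le> (1/4)\<^sup>2"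
    using assms power_mono[of "\<bar>Re z\<bar>" "1/2" 2] power_mono[of "Im z" "1/4" 2] pos by auto
  hence "2 * (norm z)\<^sup>2 \<le> 5/8"
    unfolding cmod_power2 by (simp add: power2_eq_square)
  moreover have "0 < 2 * (norm z)\<^sup>2"
    using Hplane_nonzero[OF assms(1)] by simp
  ultimately have "Im z / (5/8) \<le> Im z / (2 * (norm z)\<^sup>2)"
    using pos by (intro divide_left_mono) auto
  also have "\<dots> = Im (- 1 / (2 * z))"
    by (simp add: Im_divide cmod_power2 power_mult_distrib divide_simps)
  finally show ?thesis
    by simp
qed

context
  fixes G :: "complex \<Rightarrow> complex"
  assumes T: "\<And>z. z \<in> Hplane \<Longrightarrow> G (z + 1) = G z"
    and W: "\<And>z. z \<in> Hplane \<Longrightarrow> G (- 1 / (2 * z)) = G z"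
begin

lemma Fricke_invariant_strip:
  assumes z: "z \<in> Hplane"
  obtains w where "\<bar>Re w\<bar> \<le> 1/2" "Im w = Im z" "G w = G z"
proof -
  define w where "w = z + of_int (- round (Re z))"
  have "\<bar>Re w\<bar> \<le> 1/2" "Im w = Im z"
    using of_int_round_abs_le[of "Re z"] by (simp_all add: w_def abs_minus_commute)
  moreover have "G w = G z"
    unfolding w_def using shift_int_multiplier[of G 1 z "- round (Re z)"] T z by simp
  ultimately show thesis
    by (rule that)
qed

lemma Fricke_invariant_reduction:
  assumes "z \<in> Hplane"
  obtains w where "\<bar>Re w\<bar> \<le> 1/2" "Im w \<ge> 1/4" "G w = G z"
proof -
  have "\<exists>w. \<bar>Re w\<bar> \<le> 1/2 \<and> Im w \<ge> 1/4 \<and> G w = G z"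
    if "z \<in> Hplane" "Im z \<ge> (5/8) ^ n / 4" for n z
    using that
  proof (induction n arbitrary: z)
    case 0
    obtain w where "\<bar>Re w\<bar> \<le> 1/2" "Im w = Im z" "G w = G z"
      using Fricke_invariant_strip 0 by blast
    thus ?case
      using 0 by auto
  next
    case (Suc n)
    obtain w where w: "\<bar>Re w\<bar> \<le> 1/2" "Im w = Im z" "G w = G z"
      using Fricke_invariant_strip Suc.prems by blast
    hence w': "w \<in> Hplane"
      using Suc.prems by (simp add: in_Hplane_iff)
    show ?case
    proof (cases "Im w \<ge> 1/4")
      case False
      hence "Im (- 1 / (2 * w)) \<ge> (5/8) ^ n / 4"
        using Im_Fricke_ge[OF w' w(1)] Suc.prems w(2) by simp
      from Suc.IH[OF Hplane_Fricke[OF w'] this] show ?thesis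
        using W[OF w'] w(3) by simp
    qed (use w in auto)
  qed
  moreover obtain n where "(5/8) ^ n < 4 * Im z"
    using real_arch_pow_inv[of "4 * Im z" "5/8"] assms by (auto simp: in_Hplane_iff)
  ultimately show thesis
    using that assms by (metis less_eq_real_def mult.commute pos_divide_le_eq zero_less_numeral)
qed

lemma Fricke_invariant_attains_max:
  assumes hol: "G holomorphic_on Hplane" and lim: "(G \<longlongrightarrow> L) Im_at_top"
    and z0: "z0 \<in> Hplane" "G z0 \<noteq> L"
  obtains \<xi> where "\<xi> \<in> Hplane" "\<And>z. z \<in> Hplane \<Longrightarrow> norm (G z - L) \<le> norm (G \<xi> - L)"
proof -
  have pos: "norm (G z0 - L) > 0"
    using z0(2) by simp
  obtain Y where Y: "\<And>z. Im z \<ge> Y \<Longrightarrow> norm (G z - L) < norm (G z0 - L)"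
    using tendstoD[OF lim pos] by (auto simp: eventually_filtercomap_at_top_linorder dist_norm)
  define K where "K = cbox (Complex (-1/2) (1/4)) (Complex (1/2) (max Y 1))"
  have K: "K \<subseteq> Hplane"
    by (auto simp: K_def in_cbox_complex_iff in_Hplane_iff)
  have reduction: "norm (G z - L) < norm (G z0 - L) \<or> (\<exists>w\<in>K. G w = G z)" if z: "z \<in> Hplane" for z
  proof -
    obtain w where w: "\<bar>Re w\<bar> \<le> 1/2" "Im w \<ge> 1/4" "G w = G z"
      using Fricke_invariant_reduction[OF z] by blast
    show ?thesis
    proof (cases "Im w \<ge> Y")
      case True
      thus ?thesis
        using Y[of w] w(3) by simp
    next
      case False
      hence "w \<in> K"
        using w by (auto simp: K_def in_cbox_complex_iff abs_le_iff)
      thus ?thesis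
        using w(3) by blast
    qed
  qed
  then obtain w0 where w0: "w0 \<in> K" "G w0 = G z0"
    using z0(1) by blast
  have "continuous_on K (\<lambda>z. norm (G z - L))"
    using holomorphic_on_imp_continuous_on[OF holomorphic_on_subset[OF hol K]] by (intro continuous_intros)
  then obtain \<xi> where \<xi>: "\<xi> \<in> K" "\<And>z. z \<in> K \<Longrightarrow> norm (G z - L) \<le> norm (G \<xi> - L)"
    using continuous_attains_sup[of K "\<lambda>z. norm (G z - L)"] w0 by (auto simp: K_def)
  have "norm (G z - L) \<le> norm (G \<xi> - L)" if "z \<in> Hplane" for z
    using reduction[OF that] \<xi>(2)[OF w0(1)] \<xi>(2) w0(2) by fastforce
  thus thesis
    using that \<xi>(1) K by blast
qed

lemma Fricke_invariant_constant:
  assumes hol: "G holomorphic_on Hplane" and lim: "(G \<longlongrightarrow> L) Im_at_top" and z: "z \<in> Hplane"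
  shows "G z = L"
proof (rule ccontr)
  assume ne: "G z \<noteq> L"
  then obtain \<xi> where \<xi>: "\<xi> \<in> Hplane" "\<And>z. z \<in> Hplane \<Longrightarrow> norm (G z - L) \<le> norm (G \<xi> - L)"
    using Fricke_invariant_attains_max[OF hol lim z] by blast
  have "(\<lambda>z. G z - L) constant_on Hplane"
    using \<xi> convex_connected[OF convex_Hplane]
    by (intro maximum_modulus_principle[of _ Hplane Hplane \<xi>] holomorphic_intros hol open_Hplane) auto
  then obtain c where c: "\<And>w. w \<in> Hplane \<Longrightarrow> G w - L = c"
    by (auto simp: constant_on_def)
  have "eventually (\<lambda>w. G w = G z) Im_at_top"
    unfolding eventually_filtercomap_at_top_linorder
    using c c[OF z] by (intro exI[of _ 1]) (auto simp: in_Hplane_iff algebra_simps)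
  hence "(G \<longlongrightarrow> G z) Im_at_top"
    by (rule tendsto_eventually)
  moreover have "Im_at_top \<noteq> bot"
    by (rule filtercomap_neq_bot_surj[OF trivial_limit_at_top_linorder surjI[of Im "Complex 0"]]) simp
  ultimately show False
    using tendsto_unique lim ne by blast
qed

end

section \<open>The building blocks \<open>h\<^sub>2\<close> and \<open>\<psi>\<close>\<close>

definition psi :: "complex \<Rightarrow> complex" where
  "psi z = (eta z / eta (2 * z)) ^ 12"

lemma psi_nonzero: "z \<in> Hplane \<Longrightarrow> psi z \<noteq> 0"
  by (simp add: psi_def eta_nonzero Hplane_double)

lemma h2_nonzero: "z \<in> Hplane \<Longrightarrow> h2 z \<noteq> 0"
  by (simp add: h2_def eta_nonzero Hplane_double)

lemma eta_double_holomorphic: "(\<lambda>z. eta (2 * z)) holomorphic_on Hplane"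
  using holomorphic_on_compose_gen[of "\<lambda>z. 2 * z" Hplane eta Hplane] eta_holomorphic Hplane_double
  by (auto simp: o_def intro!: holomorphic_intros)

lemma h2_holomorphic: "h2 holomorphic_on Hplane"
  unfolding h2_def[abs_def] by (intro holomorphic_intros eta_holomorphic eta_double_holomorphic)

lemma psi_holomorphic: "psi holomorphic_on Hplane"
  unfolding psi_def[abs_def]
  by (intro holomorphic_intros eta_holomorphic eta_double_holomorphic) (simp add: eta_nonzero Hplane_double)

lemma eta_square_Fricke:
  assumes "z \<in> Hplane"
  shows "eta (- 1 / (2 * z)) ^ 2 = - 2 * \<i> * z * eta (2 * z) ^ 2"
    and "eta (2 * (- 1 / (2 * z))) ^ 2 = - \<i> * z * eta z ^ 2"
  using eta_square_neg_inverse[OF assms] eta_square_neg_inverse[OF Hplane_double[OF assms]]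
  by (simp_all add: mult_ac)

lemma h2_Fricke: "z \<in> Hplane \<Longrightarrow> h2 (- 1 / (2 * z)) = - 2 * z\<^sup>2 * h2 z"
  unfolding h2_def eta_square_Fricke by (simp add: power2_eq_square)

lemma psi_Fricke:
  assumes "z \<in> Hplane"
  shows "psi (- 1 / (2 * z)) = 64 / psi z"
proof -
  have psi: "psi w = (eta w ^ 2 / eta (2 * w) ^ 2) ^ 6" for w
    by (simp add: psi_def flip: power_divide power_mult)
  show ?thesis
    unfolding psi eta_square_Fricke[OF assms] using Hplane_nonzero[OF assms]
    by (simp add: power_divide power_mult_distrib)
qed

lemma eta_conv_qpow: "eta z = qpow 24 1 z * euler_phi (nome z)"
  by (simp add: eta_conv_euler_phi qpow_def)

lemma eta_double_conv_qpow: "eta (2 * z) = qpow 24 2 z * euler_phi (nome z ^ 2)"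
proof -
  have "nome (2 * z) = nome z ^ 2"
    by (simp add: mult_ac flip: exp_double)
  thus ?thesis
    by (simp add: eta_conv_qpow) (simp add: qpow_def mult_ac)
qed

lemma h2_conv_qpow: "h2 z = qpow 4 1 z * (euler_phi (nome z) ^ 2 * euler_phi (nome z ^ 2) ^ 2)"
proof -
  have "qpow 24 1 z ^ 2 * qpow 24 2 z ^ 2 = qpow 4 1 z"
    by (simp add: qpow_def flip: exp_of_nat_mult exp_add)
  hence "qpow 4 1 z = qpow 24 1 z ^ 2 * qpow 24 2 z ^ 2"
    by simp
  thus ?thesis
    unfolding h2_def eta_double_conv_qpow eta_conv_qpow[of z] by (simp only: power_mult_distrib mult_ac)
qed

lemma psi_conv_qpow: "psi z = qpow 4 (- 2) z * (euler_phi (nome z) / euler_phi (nome z ^ 2)) ^ 12"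
proof -
  have "(qpow 24 1 z / qpow 24 2 z) ^ 12 = qpow 4 (- 2) z"
    by (simp add: qpow_def mult_ac flip: exp_of_nat_mult exp_diff)
  hence "qpow 4 (- 2) z = (qpow 24 1 z / qpow 24 2 z) ^ 12"
    by simp
  thus ?thesis
    unfolding psi_def eta_double_conv_qpow eta_conv_qpow[of z]
    by (simp only: times_divide_times_eq flip: power_mult_distrib)
qed

lemma h2_psi_q_expansion:
  obtains a where "q_expansion 4 a (\<lambda>z. h2 z * psi z powi k)" "\<And>n. n < 1 - 2 * k \<Longrightarrow> a n = 0"
    "a (1 - 2 * k) = 1" "\<And>n. a n \<noteq> 0 \<Longrightarrow> n mod 4 = (1 - 2 * k) mod 4"
proof -
  define R where "R = (\<lambda>x. euler_phi x ^ 2 * euler_phi (x ^ 2) ^ 2 *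
    ((euler_phi x / euler_phi (x ^ 2)) ^ 12) powi k)"
  have square: "norm (x ^ 2) < 1" if "norm x < 1" for x :: complex
    using norm_power_Suc_less_one[OF that, of 1] by (simp add: numeral_2_eq_2)
  hence "(\<lambda>x. euler_phi (x ^ 2)) holomorphic_on ball 0 1"
    by (intro holomorphic_on_compose_gen[OF _ euler_phi_holomorphic, unfolded o_def])
       (auto intro!: holomorphic_intros)
  hence hol: "R holomorphic_on ball 0 1"
    unfolding R_def using square euler_phi_nonzero
    by (intro holomorphic_intros holomorphic_on_power_int euler_phi_holomorphic) auto
  have factorization: "h2 z * psi z powi k = qpow 4 (1 - 2 * k) z * R (nome z)" for z
  proof -
    have "qpow 4 (- 2) z powi k = qpow 4 (- 2 * k) z"
      by (simp add: qpow_def exp_power_int algebra_simps)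
    moreover have "qpow 4 (1 - 2 * k) z = qpow 4 1 z * qpow 4 (- 2 * k) z"
      using qpow_exponent_add[of 4 1 "- 2 * k" z] by simp
    ultimately show ?thesis
      by (simp add: R_def h2_conv_qpow psi_conv_qpow power_int_mult_distrib mult_ac)
  qed
  obtain a where "q_expansion 4 a (\<lambda>z. h2 z * psi z powi k)" "\<And>n. n < 1 - 2 * k \<Longrightarrow> a n = 0"
    "a (1 - 2 * k) = R 0" "\<And>n. a n \<noteq> 0 \<Longrightarrow> n mod int 4 = (1 - 2 * k) mod int 4"
    by (rule q_expansion_of_holomorphic[OF zero_less_numeral hol factorization]) blast
  moreover have "R 0 = 1"
    by (simp add: R_def euler_phi_0)
  ultimately show thesis
    using that[of a] unfolding of_nat_numeral by metis
qed

lemma slash_2_Fricke_eigenform_iff: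
  "slash_eigenform 2 (imat 0 (-1) 2 0) s f \<longleftrightarrow> (\<forall>z\<in>Hplane. f (- 1 / (2 * z)) = 2 * s * z\<^sup>2 * f z)"
proof -
  have "slash 2 (imat 0 (-1) 2 0) f z = f (- 1 / (2 * z)) / (2 * z\<^sup>2)" for z
    by (simp add: slash_def power_int_minus power_mult_distrib inverse_eq_divide)
  moreover have "f (- 1 / (2 * z)) / (2 * z\<^sup>2) = s * f z \<longleftrightarrow> f (- 1 / (2 * z)) = 2 * s * z\<^sup>2 * f z"
    if "z \<in> Hplane" for z
    using Hplane_nonzero[OF that] by (simp add: divide_eq_eq mult_ac)
  ultimately show ?thesis
    by (simp add: slash_eigenform_def)
qed

lemma h2_Fricke_form:
  obtains a where "Fricke_form 2 1 (-1) a h2" "\<And>n. n \<le> 0 \<Longrightarrow> a n = 0" "a 1 = 1"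
proof -
  obtain a where "q_expansion 4 a h2" "\<And>n. n < 1 \<Longrightarrow> a n = 0" "a 1 = 1" "\<And>n. a n \<noteq> 0 \<Longrightarrow> n mod 4 = 1"
    using h2_psi_q_expansion[of 0] by auto
  thus thesis
    using that[of a] h2_holomorphic h2_Fricke
    unfolding Fricke_form_def slash_2_Fricke_eigenform_iff by auto
qed

section \<open>Forms of weight two are determined by their principal parts\<close>

definition sturm_bound :: "complex \<Rightarrow> int" where
  "sturm_bound s = (if s = - 1 then 1 else 0)"

lemma Fricke_fixed_point:
  obtains w where "w \<in> Hplane" "- 1 / (2 * w) = w" "2 * w\<^sup>2 = - 1"
proof -
  define w where "w = \<i> / of_real (sqrt 2)"
  have w: "w \<in> Hplane" "2 * w\<^sup>2 = - 1"
    by (simp_all add: w_def in_Hplane_iff power_divide flip: of_real_power)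
  moreover have "- 1 / (2 * w) = w"
    unfolding w(2)[symmetric] using Hplane_nonzero[OF w(1)] by (simp add: power2_eq_square)
  ultimately show thesis
    using that by blast
qed

lemma Fricke_form_quotient_fourth_power:
  assumes F: "Fricke_form 2 e s a F" and s: "s \<in> {1, - 1}" and a: "\<And>n. n \<le> 0 \<Longrightarrow> a n = 0"
    and z: "z \<in> Hplane"
  shows "(F z / h2 z) ^ 4 = a 1 ^ 4"
proof (rule Fricke_invariant_constant[OF _ _ _ _ z])
  obtain b where b: "Fricke_form 2 1 (-1) b h2" "\<And>n. n \<le> 0 \<Longrightarrow> b n = 0" "b 1 = 1"
    using h2_Fricke_form by blast
  show "(F (w + 1) / h2 (w + 1)) ^ 4 = (F w / h2 w) ^ 4" if "w \<in> Hplane" for w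
  proof -
    have "(\<i> powi e) ^ 4 = \<i> powi (e * 4)"
      unfolding power_int_mult by simp
    also have "\<dots> = 1"
      using imaginary_unit_powi_cong[of "e * 4" 0] by simp
    finally show ?thesis
      using Fricke_form_translation[OF F that] Fricke_form_translation[OF b(1) that]
      by (simp add: power_divide power_mult_distrib)
  qed
  show "(F (- 1 / (2 * w)) / h2 (- 1 / (2 * w))) ^ 4 = (F w / h2 w) ^ 4" if w: "w \<in> Hplane" for w
  proof -
    have "F (- 1 / (2 * w)) / h2 (- 1 / (2 * w)) = - s * (F w / h2 w)"
      using Fricke_formD(2)[OF F] h2_Fricke[OF w] Hplane_nonzero[OF w] w
      unfolding slash_2_Fricke_eigenform_iff by simp
    thus ?thesis
      using s by (auto simp: power_mult_distrib)
  qed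
  show "(\<lambda>z. (F z / h2 z) ^ 4) holomorphic_on Hplane"
    using h2_nonzero by (intro holomorphic_intros h2_holomorphic Fricke_formD(1)[OF F]) auto
  have "((\<lambda>z. (F z * qpow 4 (- 1) z) / (h2 z * qpow 4 (- 1) z)) \<longlongrightarrow> a 1 / b 1) Im_at_top"
    using a b(2,3) by (intro tendsto_divide q_expansion_leading_coeff Fricke_formD(3)[OF F] Fricke_formD(3)[OF b(1)]) auto
  thus "((\<lambda>z. (F z / h2 z) ^ 4) \<longlongrightarrow> a 1 ^ 4) Im_at_top"
    by (intro tendsto_power) (simp add: b(3) qpow_def)
qed

lemma Fricke_form_vanishing:
  assumes F: "Fricke_form 2 e s a F" and s: "s \<in> {1, - 1}"
    and a: "\<And>n. n \<le> sturm_bound s \<Longrightarrow> a n = 0" and z: "z \<in> Hplane"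
  shows "F z = 0"
proof -
  have quotient: "(F w / h2 w) ^ 4 = a 1 ^ 4" if "w \<in> Hplane" for w
    using a by (intro Fricke_form_quotient_fourth_power[OF F s _ that]) (simp add: sturm_bound_def)
  have "a 1 = 0"
  proof (cases "s = 1")
    case True
    obtain w where w: "w \<in> Hplane" "- 1 / (2 * w) = w" "2 * w\<^sup>2 = - 1"
      by (rule Fricke_fixed_point)
    have "F w = 2 * w\<^sup>2 * F w"
      using Fricke_formD(2)[OF F] w(1,2) True unfolding slash_2_Fricke_eigenform_iff by force
    hence "F w = 0"
      unfolding w(3) by (simp add: eq_neg_iff_add_eq_0 flip: mult_2)
    thus ?thesis
      using quotient[OF w(1)] by simp
  next
    case False
    thus ?thesis
      using a[of 1] s by (simp add: sturm_bound_def)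
  qed
  hence "F z / h2 z = 0"
    using quotient[OF z] by simp
  thus ?thesis
    using h2_nonzero[OF z] by simp
qed

lemma Fricke_form_eqI:
  assumes f: "Fricke_form 2 e s a f" and g: "Fricke_form 2 e s b g" and s: "s \<in> {1, - 1}"
    and coeffs: "\<And>n. n \<le> sturm_bound s \<Longrightarrow> a n = b n" and z: "z \<in> Hplane"
  shows "f z = g z"
  using Fricke_form_vanishing[OF Fricke_form_diff_cmult[OF f g, of 1] s _ z] coeffs by simp

lemma h2_psi_power_Fricke:
  assumes s: "s \<in> {1, - 1}"
  shows "slash_eigenform 2 (imat 0 (-1) 2 0) s (\<lambda>z. h2 z * (psi z ^ k - s * 64 ^ k / psi z ^ k))"
  unfolding slash_2_Fricke_eigenform_iff
proof
  fix z assume z: "z \<in> Hplane"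
  have "h2 (- 1 / (2 * z)) * (psi (- 1 / (2 * z)) ^ k - s * 64 ^ k / psi (- 1 / (2 * z)) ^ k) =
      - 2 * z\<^sup>2 * h2 z * (64 ^ k / psi z ^ k - s * psi z ^ k)"
    unfolding h2_Fricke[OF z] psi_Fricke[OF z] using psi_nonzero[OF z] by (simp add: power_divide)
  also have "\<dots> = 2 * s * z\<^sup>2 * (h2 z * (psi z ^ k - s * 64 ^ k / psi z ^ k))"
    using s by (auto simp: algebra_simps)
  finally show "h2 (- 1 / (2 * z)) * (psi (- 1 / (2 * z)) ^ k - s * 64 ^ k / psi (- 1 / (2 * z)) ^ k) =
      2 * s * z\<^sup>2 * (h2 z * (psi z ^ k - s * 64 ^ k / psi z ^ k))" .
qed

lemma Fricke_form_with_leading_term: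
  fixes k :: nat
  assumes s: "s \<in> {1, - 1}" and k: "k > 0"
  obtains a f where "Fricke_form 2 (1 - 2 * int k) s a f" "a (1 - 2 * int k) = 1"
    "\<And>n. n < 1 - 2 * int k \<Longrightarrow> a n = 0"
proof -
  obtain a where a: "q_expansion 4 a (\<lambda>z. h2 z * psi z powi int k)" "\<And>n. n < 1 - 2 * int k \<Longrightarrow> a n = 0"
    "a (1 - 2 * int k) = 1" "\<And>n. a n \<noteq> 0 \<Longrightarrow> n mod 4 = (1 - 2 * int k) mod 4"
    using h2_psi_q_expansion[of "int k"] by blast
  obtain b where b: "q_expansion 4 b (\<lambda>z. h2 z * psi z powi (- int k))" "\<And>n. n < 1 - 2 * (- int k) \<Longrightarrow> b n = 0"
    "\<And>n. b n \<noteq> 0 \<Longrightarrow> n mod 4 = (1 - 2 * (- int k)) mod 4"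
    by (rule h2_psi_q_expansion[of "- int k"]) blast
  define c where "c = (\<lambda>n. a n + (- s * 64 ^ k) * b n)"
  define f where "f = (\<lambda>z. h2 z * psi z powi int k + (- s * 64 ^ k) * (h2 z * psi z powi (- int k)))"
  have "f = (\<lambda>z. h2 z * (psi z ^ k - s * 64 ^ k / psi z ^ k))"
    unfolding f_def by (simp add: power_int_minus field_simps)
  hence "slash_eigenform 2 (imat 0 (-1) 2 0) s f"
    using h2_psi_power_Fricke[OF s] by simp
  moreover have "f holomorphic_on Hplane"
    unfolding f_def using psi_nonzero
    by (intro holomorphic_intros holomorphic_on_power_int h2_holomorphic psi_holomorphic) auto
  moreover have "q_expansion 4 c f"
    unfolding c_def f_def by (intro q_expansion_add q_expansion_cmult a(1) b(1))
  moreover have "n mod 4 = (1 - 2 * int k) mod 4" if "c n \<noteq> 0" for n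
  proof -
    have "a n \<noteq> 0 \<or> b n \<noteq> 0"
      using that by (auto simp: c_def)
    moreover have "(1 - 2 * (- int k)) mod 4 = (1 - 2 * int k) mod 4"
      by (simp add: mod_eq_dvd_iff)
    ultimately show ?thesis
      using a(4) b(3) by metis
  qed
  ultimately have "Fricke_form 2 (1 - 2 * int k) s c f"
    unfolding Fricke_form_def by blast
  moreover have "c n = a n" if "n \<le> 1 - 2 * int k" for n
    using that k b(2)[of n] by (simp add: c_def)
  ultimately show thesis
    using that a(2,3) by simp
qed

lemma Fricke_form_with_top_coeff:
  assumes c: "\<And>n. c n \<noteq> 0 \<Longrightarrow> n mod 4 = e mod 4" "\<And>n. n \<le> 0 \<Longrightarrow> c n = 0"
  shows "\<exists>a f. Fricke_form 2 e s a f \<and> (\<forall>n\<le>sturm_bound s. a n = c n)"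
proof (cases "sturm_bound s = 1 \<and> c 1 \<noteq> 0")
  case True
  obtain b where b: "Fricke_form 2 1 (-1) b h2" "\<And>n. n \<le> 0 \<Longrightarrow> b n = 0" "b 1 = 1"
    using h2_Fricke_form by blast
  have "1 mod 4 = e mod 4" "s = - 1"
    using True c(1)[of 1] by (auto simp: sturm_bound_def split: if_splits)
  hence "Fricke_form 2 e s b h2"
    using b(1) Fricke_form_exponent_cong by blast
  moreover have "c 1 * b n = c n" if "n \<le> sturm_bound s" for n
    using that True b(2)[of n] b(3) c(2)[of n] by (cases "n = 1") auto
  ultimately show ?thesis
    using Fricke_form_cmult by blast
next
  case False
  have "0 = c n" if "n \<le> sturm_bound s" for n
    using that False c(2)[of n] by (cases "n = 1") (auto simp: sturm_bound_def split: if_splits)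
  thus ?thesis
    using Fricke_form_zero[of 2 e s] by (intro exI[of _ "\<lambda>_. 0"]) auto
qed

lemma Fricke_form_eliminate_leading_term:
  fixes k :: nat
  assumes s: "s \<in> {1, - 1}" and k: "k > 0" and c: "c (1 - 2 * int k) \<noteq> 0"
    and support: "\<And>n. c n \<noteq> 0 \<Longrightarrow> n mod 4 = e mod 4" and low: "\<And>n. n < 1 - 2 * int k \<Longrightarrow> c n = 0"
  obtains b B where "Fricke_form 2 e s b B" "c (1 - 2 * int k) - b (1 - 2 * int k) = 0"
    "\<And>n. n < 1 - 2 * int k \<Longrightarrow> c n - b n = 0"
proof -
  obtain b B where B: "Fricke_form 2 (1 - 2 * int k) s b B" "b (1 - 2 * int k) = 1"
    "\<And>n. n < 1 - 2 * int k \<Longrightarrow> b n = 0"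
    using Fricke_form_with_leading_term[OF s k] by blast
  have "Fricke_form 2 e s b B"
    using B(1) Fricke_form_exponent_cong support[OF c] by blast
  from Fricke_form_cmult[OF this] show thesis
    by (rule that) (use B low in simp_all)
qed

lemma Fricke_form_with_coeffs_exists:
  assumes s: "s \<in> {1, - 1}" and e: "odd e"
    and "\<And>n. c n \<noteq> 0 \<Longrightarrow> n mod 4 = e mod 4" "\<And>n. n < 1 - 2 * int k \<Longrightarrow> c n = 0"
  shows "\<exists>a f. Fricke_form 2 e s a f \<and> (\<forall>n\<le>sturm_bound s. a n = c n)"
  using assms(3-)
proof (induction k arbitrary: c)
  case 0
  thus ?case
    by (intro Fricke_form_with_top_coeff) auto
next
  case (Suc k)
  define m where "m = 1 - 2 * int (Suc k)"
  have low: "c n = 0" if "n < m" for n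
    using Suc.prems(2) that by (simp add: m_def)
  obtain b B where B: "Fricke_form 2 e s b B" "c m - b m = 0" "\<And>n. n < m \<Longrightarrow> c n - b n = 0"
  proof (cases "c m = 0")
    case True
    thus thesis
      using that[OF Fricke_form_zero] low by simp
  next
    case False
    thus thesis
      using Fricke_form_eliminate_leading_term[OF s, of "Suc k" c e] Suc.prems that by (auto simp: m_def)
  qed
  have support: "n mod 4 = e mod 4" if "c n - b n \<noteq> 0" for n
    using that Suc.prems(1)[of n] Fricke_formD(4)[OF B(1), of n] by (cases "c n = 0") auto
  have "c (m + 1) - b (m + 1) = 0"
  proof (rule ccontr)
    assume "c (m + 1) - b (m + 1) \<noteq> 0"
    from support[OF this] e show False
      unfolding m_def by presburger
  qed
  hence "c n - b n = 0" if "n < 1 - 2 * int k" for n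
    using that B(2,3) by (cases "n = m \<or> n = m + 1") (auto simp: m_def)
  with support obtain a f where a: "Fricke_form 2 e s a f" "\<And>n. n \<le> sturm_bound s \<Longrightarrow> a n = c n - b n"
    using Suc.IH[of "\<lambda>n. c n - b n"] by blast
  show ?case
    using Fricke_form_add[OF a(1) B(1)] a(2)
    by (intro exI[of _ "\<lambda>n. a n + b n"] exI[of _ "\<lambda>z. f z + B z"]) simp
qed

section \<open>Hecke operators\<close>

lemma heckeP_conv:
  assumes p: "p > 0"
  shows "heckeP k t p f z =
    (\<Sum>j<p. f ((z + of_nat (t * j)) / of_nat p)) / of_nat p + of_nat p powi (k - 1) * f (of_nat p * z)"
proof -
  define P where "P = real p"
  have P: "P > 0"
    using p by (simp add: P_def)
  have "P powr (of_int k / 2 - 1) * P powr (- of_int k / 2) = 1 / P"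
    using P powr_add[of P "of_int k / 2 - 1" "- of_int k / 2"] by (simp add: powr_minus inverse_eq_divide)
  from arg_cong[OF this, of complex_of_real]
  have translate_factor: "of_real (P powr (of_int k / 2 - 1)) * of_real (P powr (- of_int k / 2)) = (1 / of_nat p :: complex)"
    by (simp only: of_real_mult of_real_divide of_real_1 P_def of_real_of_nat_eq)
  have "P powr (of_int k / 2 - 1) * P powr (of_int k / 2) = P powi (k - 1)"
    using P powr_add[of P "of_int k / 2 - 1" "of_int k / 2"] powr_real_of_int'[of P "k - 1"] by simp
  from arg_cong[OF this, of complex_of_real]
  have "of_real (P powr (of_int k / 2 - 1)) * of_real (P powr (of_int k / 2)) = (of_nat p powi (k - 1) :: complex)"
    by (simp only: of_real_mult of_real_power_int P_def of_real_of_nat_eq)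
  moreover have "slash k (P, 0, 0, 1) f z = of_real (P powr (of_int k / 2)) * f (of_nat p * z)"
    by (simp add: slash_def P_def)
  moreover have "slash k (1, real (t * j), 0, P) f z =
      of_real (P powr (- of_int k / 2)) * f ((z + of_nat (t * j)) / of_nat p)" for j
    using slash_translate_divide[OF P, of k "real (t * j)"] by (simp add: P_def)
  ultimately show ?thesis
    using translate_factor unfolding heckeP_def P_def[symmetric]
    by (simp add: distrib_left sum_distrib_left mult.assoc[symmetric] sum_divide_distrib)
qed

lemma exp_root_of_unity_eq_1_iff:
  assumes "p > 0"
  shows "exp (2 * of_real pi * \<i> * of_int n / of_nat p) = 1 \<longleftrightarrow> int p dvd n"
proof -
  have "Im (2 * of_real pi * \<i> * of_int n / of_nat p) = of_int (2 * j) * pi \<longleftrightarrow> n = int p * j" for j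
  proof -
    have "Im (2 * of_real pi * \<i> * of_int n / of_nat p) = of_int (2 * j) * pi \<longleftrightarrow> real_of_int n = real_of_int (int p * j)"
      using assms by (simp add: Im_divide_of_nat field_simps)
    thus ?thesis
      by (simp only: of_int_eq_iff)
  qed
  thus ?thesis
    unfolding exp_eq_1 dvd_def by (simp add: Re_divide_of_nat)
qed

lemma sum_roots_of_unity:
  assumes p: "p > 0"
  shows "(\<Sum>j<p. exp (2 * of_real pi * \<i> * of_int n / of_nat p) ^ j) = (if int p dvd n then of_nat p else 0)"
proof -
  define w where "w = exp (2 * of_real pi * \<i> * of_int n / of_nat p)"
  have "w ^ p = exp (2 * of_int n * of_real pi * \<i>)"
    unfolding w_def exp_of_nat_mult[symmetric] using p by (simp add: algebra_simps)
  also have "\<dots> = 1"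
    using exp_integer_2pi[of "of_int n"] by simp
  finally show ?thesis
    using exp_root_of_unity_eq_1_iff[OF p, of n] by (auto simp: sum_gp_strict simp flip: w_def)
qed

lemma has_sum_finite_sum:
  fixes f :: "'i \<Rightarrow> 'a \<Rightarrow> 'b :: topological_comm_monoid_add"
  assumes "finite J" "\<And>j. j \<in> J \<Longrightarrow> (f j has_sum S j) A"
  shows "((\<lambda>x. \<Sum>j\<in>J. f j x) has_sum (\<Sum>j\<in>J. S j)) A"
  using assms by (induction J rule: finite_induct) (auto intro!: has_sum_add)

lemma qpow_average_translates:
  assumes t: "t > 0" and p: "p > 0"
  shows "(\<Sum>j<p. qpow t n ((z + of_nat (t * j)) / of_nat p)) / of_nat p =
    (if int p dvd n then qpow t n (z / of_nat p) else 0)"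
proof -
  have "qpow t n ((z + of_nat (t * j)) / of_nat p) =
      qpow t n (z / of_nat p) * exp (2 * of_real pi * \<i> * of_int n / of_nat p) ^ j" for j
    unfolding add_divide_distrib qpow_arg_add exp_of_nat_mult[symmetric] using t
    by (simp add: qpow_def algebra_simps)
  thus ?thesis
    using p by (simp add: sum_roots_of_unity[OF p] flip: sum_distrib_left)
qed

lemma has_sum_average_translates:
  assumes f: "q_expansion t a f" and t: "t > 0" and p: "p > 0" and z: "z \<in> Hplane"
  shows "((\<lambda>n. if int p dvd n then a n * qpow t n (z / of_nat p) else 0) has_sum
    (\<Sum>j<p. f ((z + of_nat (t * j)) / of_nat p)) / of_nat p) UNIV"
proof -
  have "((\<lambda>n. (\<Sum>j<p. a n * qpow t n ((z + of_nat (t * j)) / of_nat p)) / of_nat p) has_sum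
      (\<Sum>j<p. f ((z + of_nat (t * j)) / of_nat p)) / of_nat p) UNIV"
    unfolding divide_inverse using z p
    by (intro has_sum_cmult_left has_sum_finite_sum q_expansion_has_sum[OF f])
       (auto simp: in_Hplane_iff simp flip: divide_inverse)
  moreover have "(\<Sum>j<p. a n * qpow t n ((z + of_nat (t * j)) / of_nat p)) / of_nat p =
      (if int p dvd n then a n * qpow t n (z / of_nat p) else 0)" for n
  proof -
    have "(\<Sum>j<p. a n * qpow t n ((z + of_nat (t * j)) / of_nat p)) / of_nat p =
        a n * ((\<Sum>j<p. qpow t n ((z + of_nat (t * j)) / of_nat p)) / of_nat p)"
      by (simp add: sum_distrib_left)
    thus ?thesis
      unfolding qpow_average_translates[OF t p] by simp
  qed
  ultimately show ?thesis
    by (simp only:)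
qed

lemma q_expansion_average_translates:
  assumes f: "q_expansion t a f" and t: "t > 0" and p: "p > 0"
  shows "q_expansion t (\<lambda>m. a (int p * m)) (\<lambda>z. (\<Sum>j<p. f ((z + of_nat (t * j)) / of_nat p)) / of_nat p)"
proof -
  obtain N where N: "N \<le> 0" "\<And>n. n < N \<Longrightarrow> a n = 0"
    using q_expansion_bound[OF f] by blast
  have "a (int p * m) = 0" if "m < N" for m
  proof -
    have "int p * m \<le> 1 * m"
      using that N(1) p by (intro mult_right_mono_neg) auto
    thus ?thesis
      using that N(2) by simp
  qed
  moreover have "((\<lambda>m. a (int p * m) * qpow t m z) has_sum
      (\<Sum>j<p. f ((z + of_nat (t * j)) / of_nat p)) / of_nat p) UNIV" (is "(_ has_sum ?S) _")
    if z: "z \<in> Hplane" for z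
  proof -
    have "((\<lambda>n. if int p dvd n then a n * qpow t n (z / of_nat p) else 0) has_sum ?S) UNIV"
      by (rule has_sum_average_translates[OF f t p z])
    also have "?this \<longleftrightarrow> ((\<lambda>n. a n * qpow t n (z / of_nat p)) has_sum ?S) (range (\<lambda>m. int p * m))"
      by (rule has_sum_cong_neutral) auto
    also have "\<dots> \<longleftrightarrow> ((\<lambda>m. a (int p * m) * qpow t m z) has_sum ?S) UNIV"
    proof (subst has_sum_reindex)
      have "qpow t (int p * m) (z / of_nat p) = qpow t m z" for m
        using p by (simp add: qpow_def mult.assoc)
      thus "((\<lambda>n. a n * qpow t n (z / of_nat p)) \<circ> (\<lambda>m. int p * m) has_sum ?S) UNIV \<longleftrightarrow>
          ((\<lambda>m. a (int p * m) * qpow t m z) has_sum ?S) UNIV"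
        by (simp add: o_def)
    qed (use p in \<open>auto simp: inj_def\<close>)
    finally show ?thesis .
  qed
  ultimately show ?thesis
    by (auto simp: q_expansion_def)
qed

lemma q_expansion_dilate:
  assumes f: "q_expansion t a f" and p: "p > 0"
  shows "q_expansion t (\<lambda>m. if int p dvd m then a (m div int p) else 0) (\<lambda>z. f (of_nat p * z))"
proof -
  obtain N where N: "N \<le> 0" "\<And>n. n < N \<Longrightarrow> a n = 0"
    using q_expansion_bound[OF f] by blast
  have "(if int p dvd m then a (m div int p) else 0) = 0" if "m < int p * N" for m
    using that N p by auto
  moreover have "((\<lambda>m. (if int p dvd m then a (m div int p) else 0) * qpow t m z) has_sum f (of_nat p * z)) UNIV"
    if z: "z \<in> Hplane" for z
  proof -
    have "((\<lambda>n. a n * qpow t n (of_nat p * z)) has_sum f (of_nat p * z)) UNIV"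
      using z p by (intro q_expansion_has_sum[OF f]) (simp add: in_Hplane_iff)
    also have "?this \<longleftrightarrow> ((\<lambda>m. a (m div int p) * qpow t m z) has_sum f (of_nat p * z)) (range (\<lambda>n. int p * n))"
      using p by (subst has_sum_reindex) (auto simp: inj_def o_def qpow_def mult_ac)
    also have "\<dots> \<longleftrightarrow> ((\<lambda>m. (if int p dvd m then a (m div int p) else 0) * qpow t m z) has_sum f (of_nat p * z)) UNIV"
      by (rule has_sum_cong_neutral) auto
    finally show ?thesis .
  qed
  ultimately show ?thesis
    unfolding q_expansion_def by blast
qed

definition hecke_coeffs :: "int \<Rightarrow> nat \<Rightarrow> (int \<Rightarrow> complex) \<Rightarrow> int \<Rightarrow> complex" where
  "hecke_coeffs k p a m =
     a (int p * m) + of_nat p powi (k - 1) * (if int p dvd m then a (m div int p) else 0)"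

lemma q_expansion_heckeP:
  assumes "q_expansion t a f" "t > 0" "p > 0"
  shows "q_expansion t (hecke_coeffs k p a) (heckeP k t p f)"
  using q_expansion_add[OF q_expansion_average_translates[OF assms]
      q_expansion_cmult[OF q_expansion_dilate[OF assms(1,3)], of "of_nat p powi (k - 1)"]]
  by (simp add: hecke_coeffs_def[abs_def] heckeP_conv[OF assms(3), abs_def])

lemma heckeP_holomorphic:
  assumes "f holomorphic_on Hplane" "p > 0"
  shows "heckeP k t p f holomorphic_on Hplane"
  unfolding heckeP_def[abs_def] using assms
  by (intro holomorphic_intros slash_holomorphic) (auto simp: det2_tuple)

lemma exists_neg_inverse_mod_prime:
  fixes p :: nat
  assumes p: "prime p" and x: "\<not> p dvd x"
  shows "\<exists>m\<in>{1..<p}. p dvd x * m + 1"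
proof -
  have "coprime (int x) (int p)"
    using prime_imp_coprime[OF p x] by (simp add: coprime_commute)
  then obtain y where y: "[int x * y = 1] (mod int p)"
    using cong_solve_coprime_int by blast
  define m where "m = nat ((- y) mod int p)"
  have p1: "p > 1"
    using prime_gt_1_nat[OF p] .
  hence m: "int m = (- y) mod int p"
    by (simp add: m_def)
  have "[int x * int m + 1 = int x * (- y) + int x * y] (mod int p)"
    unfolding m by (intro cong_add cong_mult cong_refl cong_mod_left cong_sym[OF y]) simp
  hence "int p dvd int (x * m + 1)"
    by (simp add: cong_0_iff add.commute)
  hence dvd: "p dvd x * m + 1"
    by (simp only: of_nat_dvd_iff)
  moreover have "m \<noteq> 0"
    using dvd p1 by (intro notI) simp
  moreover have "int m < int p"
    unfolding m using p1 by simp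
  ultimately show ?thesis
    by (intro bexI[of _ m]) auto
qed

lemma neg_inverse_permutation:
  fixes p c :: nat
  assumes p: "prime p" and c: "\<not> p dvd c"
  obtains \<mu> where "bij_betw \<mu> {1..<p} {1..<p}" "\<And>j. j \<in> {1..<p} \<Longrightarrow> p dvd c * j * \<mu> j + 1"
proof -
  have small: "\<not> p dvd j" if "j \<in> {1..<p}" for j
    using that by (auto dest: dvd_imp_le)
  have "\<exists>m\<in>{1..<p}. p dvd c * j * m + 1" if "j \<in> {1..<p}" for j
    using small[OF that] c prime_dvd_mult_iff[OF p] by (intro exists_neg_inverse_mod_prime[OF p]) auto
  then obtain \<mu> where \<mu>: "\<And>j. j \<in> {1..<p} \<Longrightarrow> \<mu> j \<in> {1..<p}" "\<And>j. j \<in> {1..<p} \<Longrightarrow> p dvd c * j * \<mu> j + 1"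
    by metis
  have "inj_on \<mu> {1..<p}"
  proof (rule inj_onI)
    fix i j assume ij: "i \<in> {1..<p}" "j \<in> {1..<p}" "\<mu> i = \<mu> j"
    have "int p dvd int (c * i * \<mu> j + 1) - int (c * j * \<mu> j + 1)"
      using \<mu>(2)[OF ij(1)] \<mu>(2)[OF ij(2)] ij(3) by (intro dvd_diff) (simp_all only: of_nat_dvd_iff)
    also have "\<dots> = int (c * \<mu> j) * (int i - int j)"
      by (simp add: algebra_simps)
    finally have "int p dvd int i - int j"
      using p c small[OF \<mu>(1)[OF ij(2)]] by (simp add: prime_dvd_mult_iff)
    thus "i = j"
      using ij(1,2) by (simp flip: mod_eq_dvd_iff)
  qed
  hence "bij_betw \<mu> {1..<p} {1..<p}"
    using \<mu>(1) by (intro bij_betw_imageI endo_inj_surj) auto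
  thus thesis
    using that \<mu>(2) by blast
qed

lemma slash_slash_eigenform:
  assumes "slash_eigenform k M c f" "A \<odot> B = M \<odot> C" "det2 A > 0" "det2 B > 0" "det2 M > 0" "det2 C > 0" "z \<in> Hplane"
  shows "slash k B (slash k A f) z = c * slash k C f z"
  using slash_slash[OF assms(3,4,7)] slash_eigenform_slash[OF assms(1,5-7)] by (simp only: assms(2))

lemma slash_Fricke_hecke_translate:
  assumes f: "Fricke_form k e s a f" and k: "even k" and s: "s\<^sup>2 = 1" and p: "p > 0"
    and m: "p dvd 32 * j * m + 1" and z: "z \<in> Hplane"
  shows "slash k (imat 0 (-1) 2 0) (slash k (1, real (4 * j), 0, real p) f) z =
    s * slash k (1, real (4 * m), 0, real p) f z"
proof -
  obtain q where q: "32 * j * m + 1 = p * q"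
    using m by (rule dvdE)
  define \<gamma> where "\<gamma> = imat (int q) (int (4 * j)) (int (8 * m)) (int p)"
  have det: "int q * int p - int (4 * j) * int (8 * m) = 1"
    using arg_cong[OF q, of int] by (simp add: algebra_simps)
  have "nu0 (int q) (int (4 * j)) (int (8 * m)) (int p) = \<i> powi (4 * (int p * (int j - int m)))"
    by (simp add: nu0_def algebra_simps)
  also have "\<dots> = 1"
    using imaginary_unit_powi_cong[of "4 * (int p * (int j - int m))" 0] by simp
  finally have "slash_eigenform k \<gamma> 1 f"
    using Fricke_form_Gamma0[OF f k s det] by (simp add: \<gamma>_def)
  moreover have det_\<gamma>: "det2 \<gamma> = 1"
    using det by (simp only: \<gamma>_def det2_imat)
  ultimately have "slash_eigenform k (\<gamma> \<odot> imat 0 (-1) 2 0) (1 * s) f"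
    by (intro slash_eigenform_mult Fricke_formD(2)[OF f]) (simp_all add: det2_tuple)
  moreover have "(1, real (4 * j), 0, real p) \<odot> imat 0 (-1) 2 0 = \<gamma> \<odot> imat 0 (-1) 2 0 \<odot> (1, real (4 * m), 0, real p)"
    using arg_cong[OF q, of real] by (simp add: \<gamma>_def mat2_mult_def algebra_simps)
  ultimately have "slash k (imat 0 (-1) 2 0) (slash k (1, real (4 * j), 0, real p) f) z =
      1 * s * slash k (1, real (4 * m), 0, real p) f z"
    by (rule slash_slash_eigenform) (use p z in \<open>simp_all add: det2_mult det_\<gamma> det2_tuple\<close>)
  thus ?thesis
    by simp
qed

lemma heckeP_Fricke:
  assumes f: "Fricke_form k e s a f" and k: "even k" and s: "s\<^sup>2 = 1" and p: "prime p" "odd p"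
  shows "slash_eigenform k (imat 0 (-1) 2 0) s (heckeP k 4 p f)"
  unfolding slash_eigenform_def
proof
  fix z assume z: "z \<in> Hplane"
  let ?W = "imat 0 (-1) 2 0" and ?D = "(real p, 0, 0, 1)"
  define N :: "nat \<Rightarrow> mat2" where "N = (\<lambda>j. (1, real (4 * j), 0, real p))"
  have p0: "p > 0"
    using prime_gt_0_nat[OF p(1)] .
  have "\<not> p dvd 32"
    using p prime_dvd_power_nat[of p 2 5] primes_dvd_imp_eq[of p 2] by auto
  then obtain \<mu> where \<mu>: "bij_betw \<mu> {1..<p} {1..<p}" "\<And>j. j \<in> {1..<p} \<Longrightarrow> p dvd 32 * j * \<mu> j + 1"
    using neg_inverse_permutation[OF p(1)] by blast
  have "N 0 \<odot> ?W = ?W \<odot> ?D" "?D \<odot> ?W = ?W \<odot> N 0"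
    by (simp_all add: mat2_mult_def N_def)
  hence diagonal: "slash k ?W (slash k (N 0) f) z = s * slash k ?D f z" "slash k ?W (slash k ?D f) z = s * slash k (N 0) f z"
    using p0 z by (auto intro!: slash_slash_eigenform Fricke_formD(2)[OF f] simp: det2_tuple N_def)
  have "(\<Sum>j\<in>{1..<p}. slash k ?W (slash k (N j) f) z) = (\<Sum>j\<in>{1..<p}. s * slash k (N (\<mu> j)) f z)"
    unfolding N_def using \<mu>(2) by (intro sum.cong refl slash_Fricke_hecke_translate[OF f k s p0 _ z])
  also have "\<dots> = (\<Sum>j\<in>{1..<p}. s * slash k (N j) f z)"
    using sum.reindex_bij_betw[OF \<mu>(1)] .
  finally have translates: "(\<Sum>j\<in>{1..<p}. slash k ?W (slash k (N j) f) z) = s * (\<Sum>j\<in>{1..<p}. slash k (N j) f z)"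
    by (simp add: sum_distrib_left)
  have split: "(\<Sum>j<p. g j) = g 0 + (\<Sum>j\<in>{1..<p}. g j)" for g :: "nat \<Rightarrow> complex"
    using p0 by (simp add: lessThan_atLeast0 sum.atLeast_Suc_lessThan)
  have hecke: "heckeP k 4 p f = (\<lambda>z. of_real (real p powr (of_int k / 2 - 1)) * ((\<Sum>j<p. slash k (N j) f z) + slash k ?D f z))"
    by (simp add: heckeP_def[abs_def] N_def)
  show "slash k ?W (heckeP k 4 p f) z = s * heckeP k 4 p f z"
    unfolding hecke slash_cmult slash_add slash_sum split translates diagonal by (simp add: algebra_simps)
qed

lemma mult_square_mod_4: "odd (x :: int) \<Longrightarrow> x * x * n mod 4 = n mod 4"
  using odd_square_mod_4[of x] dvd_mult2[of 4 "x * x - 1" n] by (simp add: mod_eq_dvd_iff algebra_simps)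

lemma hecke_coeffs_support:
  assumes a: "\<And>n. a n \<noteq> 0 \<Longrightarrow> n mod 4 = e mod 4" and p: "odd p" and nz: "hecke_coeffs k p a m \<noteq> 0"
  shows "m mod 4 = int p * e mod 4"
proof -
  consider "a (int p * m) \<noteq> 0" | n where "m = int p * n" "a n \<noteq> 0"
    using nz p by (fastforce simp: hecke_coeffs_def split: if_splits)
  thus ?thesis
  proof cases
    case 1
    have "m mod 4 = int p * (int p * m) mod 4"
      using mult_square_mod_4[of "int p" m] p by (simp add: mult.assoc)
    thus ?thesis
      using a[OF 1] by (metis mod_mult_right_eq)
  next
    case 2
    thus ?thesis
      using a[OF 2(2)] by (metis mod_mult_right_eq)
  qed
qed

lemma Fricke_form_heckeP:
  assumes f: "Fricke_form k e s a f" and k: "even k" and s: "s\<^sup>2 = 1" and p: "prime p" "odd p"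
  shows "Fricke_form k (int p * e) s (hecke_coeffs k p a) (heckeP k 4 p f)"
  unfolding Fricke_form_def
proof (intro conjI allI impI)
  have p0: "p > 0"
    using prime_gt_0_nat[OF p(1)] .
  show "heckeP k 4 p f holomorphic_on Hplane"
    by (rule heckeP_holomorphic[OF Fricke_formD(1)[OF f] p0])
  show "slash_eigenform k (imat 0 (-1) 2 0) s (heckeP k 4 p f)"
    by (rule heckeP_Fricke[OF assms])
  show "q_expansion 4 (hecke_coeffs k p a) (heckeP k 4 p f)"
    using q_expansion_heckeP[OF Fricke_formD(3)[OF f] _ p0] by simp
  show "m mod 4 = int p * e mod 4" if "hecke_coeffs k p a m \<noteq> 0" for m
    using hecke_coeffs_support[OF Fricke_formD(4)[OF f] p(2) that] .
qed

fun hecke_power_coeffs :: "int \<Rightarrow> nat \<Rightarrow> nat \<Rightarrow> (int \<Rightarrow> complex) \<Rightarrow> int \<Rightarrow> complex" where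
  "hecke_power_coeffs k p 0 a = a"
| "hecke_power_coeffs k p (Suc 0) a = hecke_coeffs k p a"
| "hecke_power_coeffs k p (Suc (Suc n)) a =
     (\<lambda>m. hecke_coeffs k p (hecke_power_coeffs k p (Suc n) a) m -
          of_nat p powi (k - 1) * hecke_power_coeffs k p n a m)"

lemma Fricke_form_hecke:
  assumes f: "Fricke_form k e s a f" and k: "even k" and s: "s\<^sup>2 = 1" and p: "prime p" "odd p"
  shows "Fricke_form k (int (p ^ n) * e) s (hecke_power_coeffs k p n a) (hecke k 4 p n f)"
proof (induction n rule: induct_nat_012)
  case 0
  show ?case
    using f by simp
next
  case 1
  show ?case
    using Fricke_form_heckeP[OF assms] by simp
next
  case (ge2 n)
  have exponent: "int p * (int (p ^ Suc n) * e) = int (p ^ Suc (Suc n)) * e"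
    by simp
  hence "int (p ^ n) * e mod 4 = int (p ^ Suc (Suc n)) * e mod 4"
    using mult_square_mod_4[of "int p" "int (p ^ n) * e"] p(2) by (simp add: mult_ac)
  hence "Fricke_form k (int (p ^ Suc (Suc n)) * e) s (hecke_power_coeffs k p n a) (hecke k 4 p n f)"
    using ge2(1) Fricke_form_exponent_cong by blast
  moreover have "Fricke_form k (int (p ^ Suc (Suc n)) * e) s
      (hecke_coeffs k p (hecke_power_coeffs k p (Suc n) a)) (heckeP k 4 p (hecke k 4 p (Suc n) f))"
    using Fricke_form_heckeP[OF ge2(2) k s p] unfolding exponent .
  moreover have "complex_of_real (real p powr (of_int k - 1)) = of_nat p powi (k - 1)"
    using powr_real_of_int'[of "real p" "k - 1"] prime_gt_0_nat[OF p(1)] by simp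
  ultimately show ?case
    using Fricke_form_diff_cmult[of k _ s] by simp
qed

lemma hecke_coeffs_diff_cmult:
  "hecke_coeffs k p (\<lambda>m. a m - c * b m) m = hecke_coeffs k p a m - c * hecke_coeffs k p b m"
  by (simp add: hecke_coeffs_def algebra_simps)

lemma hecke_power_coeffs_commute:
  "hecke_power_coeffs k p n (hecke_coeffs k p a) = hecke_coeffs k p (hecke_power_coeffs k p n a)"
  by (induction n rule: induct_nat_012) (simp_all add: hecke_coeffs_diff_cmult[abs_def])

lemma hecke_power_coeffs_not_dvd:
  assumes "p > 0" "\<not> int p dvd m"
  shows "hecke_power_coeffs k p n a m = a (int (p ^ n) * m)"
proof (induction n arbitrary: a rule: induct_nat_012)
  case (ge2 n)
  have "hecke_power_coeffs k p (Suc (Suc n)) a m =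
      hecke_coeffs k p a (int (p ^ Suc n) * m) - of_nat p powi (k - 1) * a (int (p ^ n) * m)"
    by (simp only: hecke_power_coeffs.simps ge2 flip: hecke_power_coeffs_commute)
  also have "hecke_coeffs k p a (int (p ^ Suc n) * m) =
      a (int (p ^ Suc (Suc n)) * m) + of_nat p powi (k - 1) * a (int (p ^ n) * m)"
    using assms(1) by (simp add: hecke_coeffs_def mult.assoc)
  finally show ?case
    by simp
qed (use assms in \<open>simp_all add: hecke_coeffs_def\<close>)

lemma dilated_coeff_principal:
  fixes p m x :: int
  assumes "\<And>m. m \<le> 0 \<Longrightarrow> a m = (if m = x then c else 0)" "p > 0" "m \<le> 0"
  shows "(if p dvd m then a (m div p) else 0) = (if m = p * x then c else 0)"
proof (cases "p dvd m")
  case True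
  then obtain n where n: "m = p * n"
    by blast
  hence "n \<le> 0"
    using assms(2,3) by (simp add: mult_le_0_iff)
  thus ?thesis
    using assms(1)[of n] assms(2) by (simp add: n)
qed auto

lemma hecke_coeffs_principal:
  assumes a: "\<And>m. m \<le> 0 \<Longrightarrow> a m = (if m = int p * x then c else 0)" and "p > 0" "m \<le> 0"
  shows "hecke_coeffs k p a m =
    (if m = x then c else 0) + (if m = int p * (int p * x) then of_nat p powi (k - 1) * c else 0)"
proof -
  have "a (int p * m) = (if m = x then c else 0)"
    using a[of "int p * m"] assms(2,3) by (simp add: mult_le_0_iff)
  thus ?thesis
    using dilated_coeff_principal[OF a, of "int p" m] assms(2,3) by (simp add: hecke_coeffs_def)
qed

lemma hecke_power_coeffs_principal:
  assumes p: "p > 1" and a: "\<And>m. m \<le> 0 \<Longrightarrow> a m = (if m = - 1 then 1 else 0)" and "m \<le> 0"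
  shows "hecke_power_coeffs k p n a m = (if m = - int (p ^ n) then (of_nat p powi (k - 1)) ^ n else 0)"
  using assms(3)
proof (induction n arbitrary: m rule: induct_nat_012)
  case 0
  thus ?case
    using a by simp
next
  case 1
  have "a (int p * m) = 0"
    using a[of "int p * m"] p 1 by (auto simp: mult_le_0_iff zmult_eq_neg1_iff)
  moreover have "(if int p dvd m then a (m div int p) else 0) = (if m = int p * - 1 then 1 else 0)"
    using dilated_coeff_principal[OF a, of "int p" m] p 1 by simp
  ultimately show ?case
    by (simp add: hecke_coeffs_def)
next
  case (ge2 n)
  have "hecke_coeffs k p (hecke_power_coeffs k p (Suc n) a) m =
      (if m = - int (p ^ n) then (of_nat p powi (k - 1)) ^ Suc n else 0) +
      (if m = int p * (int p * - int (p ^ n)) then of_nat p powi (k - 1) * (of_nat p powi (k - 1)) ^ Suc n else 0)"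
    using p ge2(2,3) by (intro hecke_coeffs_principal) auto
  thus ?case
    using ge2(1)[OF ge2(3)] by simp
qed

section \<open>The forms \<open>f\<^sub>d\<close>\<close>

definition principal_coeffs :: "nat \<Rightarrow> nat set \<Rightarrow> (nat \<Rightarrow> complex) \<Rightarrow> int \<Rightarrow> complex" where
  "principal_coeffs d S a n = (if n = - int d then 1 else if n > 0 \<and> nat n \<in> S then a (nat n) else 0)"

lemma has_sum_insert_iff:
  fixes f :: "'a \<Rightarrow> 'b :: topological_ab_group_add"
  assumes "x \<notin> A"
  shows "(f has_sum S) (insert x A) \<longleftrightarrow> (f has_sum (S - f x)) A"
proof
  assume "(f has_sum S) (insert x A)"
  moreover have "(f has_sum f x) {x}"
    using has_sum_finite[of "{x}" f] by simp
  ultimately have "(f has_sum (S - f x)) (insert x A - {x})"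
    by (rule has_sum_Diff) simp
  thus "(f has_sum (S - f x)) A"
    using assms by simp
qed (use has_sum_insert[OF assms] in fastforce)

lemma qexp_coeffs_iff_q_expansion:
  assumes "S \<subseteq> {0<..}" "d > 0"
  shows "qexp_coeffs d S a f \<longleftrightarrow> q_expansion 4 (principal_coeffs d S a) f"
proof -
  define c where "c = principal_coeffs d S a"
  have c: "c (- int d) = 1" "\<And>n. n \<in> S \<Longrightarrow> c (int n) = a n" "\<And>n. n \<notin> insert (- int d) (int ` S) \<Longrightarrow> c n = 0"
    using assms by (auto simp: c_def principal_coeffs_def image_iff)
  have "((\<lambda>n. c n * qpow 4 n z) has_sum f z) UNIV \<longleftrightarrow>
      ((\<lambda>n. a n * qpow 4 (int n) z) has_sum (f z - qpow 4 (- int d) z)) S" for z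
  proof -
    have "((\<lambda>n. c n * qpow 4 n z) has_sum f z) UNIV \<longleftrightarrow>
        ((\<lambda>n. c n * qpow 4 n z) has_sum f z) (insert (- int d) (int ` S))"
      by (rule has_sum_cong_neutral) (auto simp: c(3))
    also have "\<dots> \<longleftrightarrow> ((\<lambda>n. c n * qpow 4 n z) has_sum (f z - qpow 4 (- int d) z)) (int ` S)"
      using assms by (subst has_sum_insert_iff) (auto simp: c(1))
    also have "\<dots> \<longleftrightarrow> ((\<lambda>n. a n * qpow 4 (int n) z) has_sum (f z - qpow 4 (- int d) z)) S"
      by (subst has_sum_reindex) (auto simp: c(2) intro!: has_sum_cong)
    finally show ?thesis .
  qed
  moreover have "\<exists>N. \<forall>n<N. c n = 0"
    by (rule exI[of _ "- int d"]) (auto simp: c_def principal_coeffs_def)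
  ultimately show ?thesis
    by (simp add: qexp_coeffs_def q_expansion_def c_def)
qed

definition tail_exponents :: "nat \<Rightarrow> complex \<Rightarrow> nat set" where
  "tail_exponents d s = {n. sturm_bound s < int n \<and> int n mod 4 = (- int d) mod 4}"

lemma int_mod_4: "int n mod 4 = int (n mod 4)"
  by (simp add: zmod_int)

lemma minus_int_mod_4:
  "d mod 4 = 1 \<Longrightarrow> (- int d) mod 4 = 3" "d mod 4 = 3 \<Longrightarrow> (- int d) mod 4 = 1"
  by (simp_all add: zmod_zminus1_eq_if int_mod_4)

lemma tail_exponents_1_mod_4:
  assumes "d mod 4 = 1"
  shows "tail_exponents d s = S3"
proof -
  have "n > 1" if "n mod 4 = 3" for n :: nat
    using that mod_less_eq_dividend[of n 4] by simp
  thus ?thesis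
    unfolding tail_exponents_def S3_def sturm_bound_def int_mod_4 minus_int_mod_4(1)[OF assms] by fastforce
qed

lemma tail_exponents_3_mod_4:
  assumes "d mod 4 = 3"
  shows "tail_exponents d s = (if s = - 1 then S5 else S1)"
proof -
  have "n > 1 \<and> n mod 4 = 1 \<longleftrightarrow> n \<ge> 5 \<and> n mod 4 = 1" for n :: nat
    by presburger
  thus ?thesis
    unfolding tail_exponents_def S1_def S5_def sturm_bound_def int_mod_4 minus_int_mod_4(2)[OF assms] by simp
qed

text \<open>The multiplier of \<open>f\<^sub>d\<close> is \<open>\<nu>\<^sup>-\<^sup>d\<close> in both residue classes of \<open>d\<close>.\<close>

lemma fd_prop_eq:
  assumes "odd d" "s \<in> {1, - 1}"
  shows "fd_prop s d f \<longleftrightarrow>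
    wh_form 2 (\<lambda>a b c u. nu0 a b c u powi (- int d)) s f \<and> qexp_shape d (tail_exponents d s) f"
proof -
  have "d mod 4 = 1 \<or> d mod 4 = 3"
    using assms(1) by presburger
  then consider "d mod 4 = 1" | "d mod 4 = 3"
    by blast
  thus ?thesis
  proof cases
    case 1
    hence "int d mod 4 = 1"
      by (simp add: int_mod_4)
    thus ?thesis
      using 1 by (simp add: fd_prop_def nu0_powi tail_exponents_1_mod_4)
  next
    case 2
    thus ?thesis
      using minus_int_mod_4(2)[OF 2] assms(2) by (auto simp: fd_prop_def nu0_powi tail_exponents_3_mod_4)
  qed
qed

lemma principal_form_iff_Fricke_form:
  assumes "odd d" "s \<in> {1, - 1}"
  shows "wh_form 2 (\<lambda>a b c u. nu0 a b c u powi (- int d)) s f \<and> qexp_coeffs d (tail_exponents d s) a f \<longleftrightarrow>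
    Fricke_form 2 (- int d) s (principal_coeffs d (tail_exponents d s) a) f"
proof -
  have "tail_exponents d s \<subseteq> {0<..}"
    by (auto simp: tail_exponents_def sturm_bound_def split: if_splits)
  hence "qexp_coeffs d (tail_exponents d s) a f \<longleftrightarrow> q_expansion 4 (principal_coeffs d (tail_exponents d s) a) f"
    using assms(1) by (intro qexp_coeffs_iff_q_expansion) (auto elim: oddE)
  moreover have "n mod 4 = (- int d) mod 4" if "principal_coeffs d (tail_exponents d s) a n \<noteq> 0" for n
    using that by (auto simp: principal_coeffs_def tail_exponents_def split: if_splits)
  moreover have "s\<^sup>2 = 1"
    using assms(2) by auto
  ultimately show ?thesis
    using wh_form_iff_Fricke_form[of 2 s "principal_coeffs d (tail_exponents d s) a" f "- int d"]
    by (auto dest: Fricke_formD(3))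
qed

lemma fd_prop_iff_Fricke_form:
  assumes d: "odd d" and s: "s \<in> {1, - 1}"
  shows "fd_prop s d f \<longleftrightarrow>
    (\<exists>a. Fricke_form 2 (- int d) s a f \<and> (\<forall>n\<le>sturm_bound s. a n = (if n = - int d then 1 else 0)))"
    (is "_ \<longleftrightarrow> (\<exists>a. ?F a \<and> ?P a)")
proof -
  have d0: "d > 0"
    using d by (auto elim: oddE)
  have "?P (principal_coeffs d (tail_exponents d s) b)" for b
    by (auto simp: principal_coeffs_def tail_exponents_def)
  moreover have "a = principal_coeffs d (tail_exponents d s) (\<lambda>n. a (int n))" if "?F a" "?P a" for a
  proof
    fix n
    show "a n = principal_coeffs d (tail_exponents d s) (\<lambda>n. a (int n)) n"
    proof (cases "n \<le> sturm_bound s")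
      case True
      thus ?thesis
        using that(2) by (auto simp: principal_coeffs_def tail_exponents_def)
    next
      case False
      hence "n > 0"
        by (simp add: sturm_bound_def split: if_splits)
      thus ?thesis
        using False Fricke_formD(4)[OF that(1), of n] d0 by (auto simp: principal_coeffs_def tail_exponents_def)
    qed
  qed
  moreover have "fd_prop s d f \<longleftrightarrow> (\<exists>b. ?F (principal_coeffs d (tail_exponents d s) b))"
    unfolding fd_prop_eq[OF assms] qexp_shape_def principal_form_iff_Fricke_form[OF assms, symmetric] by blast
  ultimately show ?thesis
    by metis
qed

lemma fd_exists_unique:
  assumes d: "odd d" and s: "s \<in> {1, - 1}"
  shows "\<exists>f. fd_prop s d f \<and> (\<forall>g. fd_prop s d g \<longrightarrow> (\<forall>z\<in>Hplane. g z = f z))"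
proof -
  define c :: "int \<Rightarrow> complex" where "c = (\<lambda>n. if n = - int d then 1 else 0)"
  have low: "c n = 0" if "n < 1 - 2 * int ((d + 1) div 2)" for n
    using that d by (auto simp: c_def elim!: oddE)
  have support: "n mod 4 = (- int d) mod 4" if "c n \<noteq> 0" for n
    using that by (simp add: c_def split: if_splits)
  obtain a f where f: "Fricke_form 2 (- int d) s a f" "\<forall>n\<le>sturm_bound s. a n = c n"
    using Fricke_form_with_coeffs_exists[where c = c and k = "(d + 1) div 2", OF s _ support low] d by auto
  have "g z = f z" if g: "fd_prop s d g" and z: "z \<in> Hplane" for g z
  proof -
    obtain b where b: "Fricke_form 2 (- int d) s b g" "\<forall>n\<le>sturm_bound s. b n = c n"
      using g fd_prop_iff_Fricke_form[OF assms] by (auto simp: c_def)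
    show ?thesis
      by (rule Fricke_form_eqI[OF b(1) f(1) s _ z]) (use b(2) f(2) in simp)
  qed
  moreover have "fd_prop s d f"
    using f fd_prop_iff_Fricke_form[OF assms] by (auto simp: c_def)
  ultimately show ?thesis
    by blast
qed

lemma hecke_power_coeffs_f1:
  assumes p: "p > 1" and m: "m \<le> 1"
  shows "hecke_power_coeffs 2 p n (principal_coeffs 1 S3 a) m =
    (if m = - int (p ^ n) then of_nat (p ^ n) else 0) +
    (if m = 1 \<and> p ^ n mod 4 = 3 then a (p ^ n) else 0)"
proof (cases "m = 1")
  case True
  have "\<not> int p dvd 1"
    using p by simp
  hence "hecke_power_coeffs 2 p n (principal_coeffs 1 S3 a) 1 = principal_coeffs 1 S3 a (int (p ^ n))"
    using hecke_power_coeffs_not_dvd[of p 1] p by simp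
  moreover have "1 \<noteq> - int (p ^ n)" "int (p ^ n) \<noteq> - 1" "p ^ n > 0"
    using p of_nat_0_le_iff[of "p ^ n"] by (linarith, linarith, simp)
  ultimately show ?thesis
    using True by (simp add: principal_coeffs_def S3_def del: of_nat_power)
next
  case False
  have "principal_coeffs 1 S3 a l = (if l = - 1 then 1 else 0)" if "l \<le> 0" for l
    using that by (simp add: principal_coeffs_def)
  from hecke_power_coeffs_principal[OF p this, of m 2 n] show ?thesis
    using False m by simp
qed

lemma hecke_eq_multiple_plus_h2:
  assumes p: "prime p" "odd p" and s: "s \<in> {1, - 1}"
    and f: "wh_form 2 nu0_conj s f" "qexp_coeffs 1 S3 a f" and g: "fd_prop s (p ^ n) g" and z: "z \<in> Hplane"
  shows "hecke 2 4 p n f z =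
    of_nat (p ^ n) * g z + (if s = - 1 \<and> p ^ n mod 4 = 3 then a (p ^ n) else 0) * h2 z"
proof -
  define c where "c = (if s = - 1 \<and> p ^ n mod 4 = 3 then a (p ^ n) else 0)"
  have "Fricke_form 2 (- 1) s (principal_coeffs 1 S3 a) f"
    using principal_form_iff_Fricke_form[of 1 s f a] f s nu0_powi(2)[of 1] by (simp add: tail_exponents_1_mod_4)
  from Fricke_form_hecke[OF this _ _ p, of n] s
  have lhs: "Fricke_form 2 (- int (p ^ n)) s (hecke_power_coeffs 2 p n (principal_coeffs 1 S3 a)) (hecke 2 4 p n f)"
    by auto
  obtain B where B: "Fricke_form 2 (- int (p ^ n)) s B g"
    "\<And>m. m \<le> sturm_bound s \<Longrightarrow> B m = (if m = - int (p ^ n) then 1 else 0)"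
    using g fd_prop_iff_Fricke_form[of "p ^ n" s g] p s by auto
  obtain b where b: "Fricke_form 2 1 (- 1) b h2" "\<And>m. m \<le> 0 \<Longrightarrow> b m = 0" "b 1 = 1"
    using h2_Fricke_form by blast
  have correction: "Fricke_form 2 (- int (p ^ n)) s (\<lambda>m. c * b m) (\<lambda>z. c * h2 z)"
  proof (cases "c = 0")
    case False
    hence "s = - 1" "1 mod 4 = (- int (p ^ n)) mod 4"
      using minus_int_mod_4(2)[of "p ^ n"] by (simp_all add: c_def split: if_splits del: of_nat_power)
    thus ?thesis
      using b(1) Fricke_form_cmult Fricke_form_exponent_cong by blast
  qed (simp add: Fricke_form_zero)
  have "hecke_power_coeffs 2 p n (principal_coeffs 1 S3 a) m = of_nat (p ^ n) * B m + c * b m"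
    if m: "m \<le> sturm_bound s" for m
  proof -
    have "m \<le> 0 \<or> m = 1 \<and> s = - 1"
      using m by (auto simp: sturm_bound_def split: if_splits)
    thus ?thesis
      using hecke_power_coeffs_f1[OF prime_gt_1_nat[OF p(1)], of m n a] B(2)[OF m] b(2)[of m] b(3)
      by (auto simp: c_def)
  qed
  from Fricke_form_eqI[OF lhs Fricke_form_add[OF Fricke_form_cmult[OF B(1)] correction] s this z]
  show ?thesis
    by (simp add: c_def)
qed

lemma hecke_f1_eq:
  assumes p: "prime p" "odd p" and s: "s \<in> {1, - 1}" "s = 1 \<or> p ^ n mod 4 = 1"
    and f: "fd_prop s 1 f" and g: "fd_prop s (p ^ n) g" and z: "z \<in> Hplane"
  shows "hecke 2 4 p n f z = of_nat (p ^ n) * g z"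
proof -
  obtain a where "wh_form 2 nu0_conj s f" "qexp_coeffs 1 S3 a f"
    using f by (auto simp: fd_prop_def qexp_shape_def)
  from hecke_eq_multiple_plus_h2[OF p s(1) this g z] s(2) show ?thesis
    by auto
qed

lemma fd_exists_unique_1_mod_4:
  assumes "d mod 4 = 1" "s \<in> {1, - 1}"
  shows "\<exists>f. wh_form 2 nu0_conj s f \<and> qexp_shape d S3 f \<and>
    (\<forall>g. wh_form 2 nu0_conj s g \<and> qexp_shape d S3 g \<longrightarrow> (\<forall>z\<in>Hplane. g z = f z))"
proof -
  have "odd d"
    using assms(1) by presburger
  thus ?thesis
    using fd_exists_unique[of d s] assms by (simp add: fd_prop_def)
qed

lemma fd_exists_unique_3_mod_4:
  assumes "d mod 4 = 3" "s \<in> {1, - 1}" "S = (if s = 1 then S1 else S5)"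
  shows "\<exists>f. wh_form 2 nu0 s f \<and> qexp_shape d S f \<and>
    (\<forall>g. wh_form 2 nu0 s g \<and> qexp_shape d S g \<longrightarrow> (\<forall>z\<in>Hplane. g z = f z))"
proof -
  have "odd d"
    using assms(1) by presburger
  thus ?thesis
    using fd_exists_unique[of d s] assms by (simp add: fd_prop_def)
qed

theorem theorem4p1:
  shows
  "(\<forall>d::nat. d > 0 \<and> d mod 4 = 1 \<longrightarrow>
      (\<forall>s\<in>{1, -1::complex}. \<exists>f. wh_form 2 nu0_conj s f \<and> qexp_shape d S3 f \<and>
          (\<forall>g. wh_form 2 nu0_conj s g \<and> qexp_shape d S3 g \<longrightarrow> (\<forall>z\<in>Hplane. g z = f z))))
   \<and> (\<forall>d::nat. d > 0 \<and> d mod 4 = 3 \<longrightarrow>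
      (\<exists>f. wh_form 2 nu0 1 f \<and> qexp_shape d S1 f \<and>
          (\<forall>g. wh_form 2 nu0 1 g \<and> qexp_shape d S1 g \<longrightarrow> (\<forall>z\<in>Hplane. g z = f z))) \<and>
      (\<exists>f. wh_form 2 nu0 (-1) f \<and> qexp_shape d S5 f \<and>
          (\<forall>g. wh_form 2 nu0 (-1) g \<and> qexp_shape d S5 g \<longrightarrow> (\<forall>z\<in>Hplane. g z = f z))))
   \<and> (\<forall>(p::nat) (n::nat). prime p \<and> odd p \<and> n \<ge> 1 \<longrightarrow>
      (\<forall>f1 g. fd_prop 1 1 f1 \<and> fd_prop 1 (p ^ n) g \<longrightarrow>
          (\<forall>z\<in>Hplane. hecke 2 4 p n f1 z = of_nat (p ^ n) * g z)) \<and>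
      (p ^ n mod 4 = 1 \<longrightarrow> (\<forall>f1 g. fd_prop (-1) 1 f1 \<and> fd_prop (-1) (p ^ n) g \<longrightarrow>
          (\<forall>z\<in>Hplane. hecke 2 4 p n f1 z = of_nat (p ^ n) * g z))) \<and>
      (p ^ n mod 4 = 3 \<longrightarrow> (\<forall>f1 a1 g. wh_form 2 nu0_conj (-1) f1 \<and> qexp_coeffs 1 S3 a1 f1
              \<and> fd_prop (-1) (p ^ n) g \<longrightarrow>
          (\<forall>z\<in>Hplane. hecke 2 4 p n f1 z = of_nat (p ^ n) * g z + a1 (p ^ n) * h2 z))))"
  (is "?a \<and> ?b \<and> ?c")
proof (intro conjI)
  show ?a
    using fd_exists_unique_1_mod_4 by blast
  show ?b
    using fd_exists_unique_3_mod_4[where s = 1] fd_exists_unique_3_mod_4[where s = "- 1"] by simp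
  have "hecke 2 4 p n f z = of_nat (p ^ n) * g z + a (p ^ n) * h2 z"
    if "prime p" "odd p" "p ^ n mod 4 = 3" "wh_form 2 nu0_conj (- 1) f" "qexp_coeffs 1 S3 a f"
      "fd_prop (- 1) (p ^ n) g" "z \<in> Hplane" for p n f a g z
    using hecke_eq_multiple_plus_h2[OF that(1,2) _ that(4-7)] that(3) by simp
  thus ?c
    using hecke_f1_eq[where s = 1] hecke_f1_eq[where s = "- 1"] by blast
qed

end
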